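(* Let $n$ and $r$ be positive integers with $r>1$. \begin{enumerate} \item ($2\mid r$ and $3\mid n$) if and only if $\mathrm{mincol}_r\, THK(3,n)=2$. \item [($2\nmid r$ or $3\nmid n$) and $3\mid r$ and $4\mid n$] if and only if $\mathrm{mincol}_r\, THK(3,n)=3$. \item [($2\nmid r$ or $3\nmid n$) and ($3\nmid r$ or $4\nmid n$) and (($5\mid r$ and $2\mid n$) or ($7\mid r$ and $8\mid n$))] if and only if $\mathrm{mincol}_r\, THK(3,n)=4$. \item If ($2\nmid r$ or $3\nmid n$) and ($3\nmid r$ or $4\nmid n$) and ($5\nmid r$ or $2\nmid n$) and ($7\nmid r$ or $8\nmid n$) and ($11\mid r$ and $5\mid n$), then $\mathrm{mincol}_r\, THK(3,n)=5$. \end{enumerate}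
   Context: "Knot" means a knot or link in 3-space. $THK(3,n)$ is the closure of the 3-strand braid $(\sigma_2\sigma_1^{-1})^n\in B_3$. For an integer $r>1$, an $r$-coloring (Fox coloring) of a knot diagram is an assignment of elements of $\mathbb{Z}_r=\mathbb{Z}/r\mathbb{Z}$ to its arcs such that at each crossing $2y-x-z=0$ in $\mathbb{Z}_r$, where $y$ is the color of the over-arc and $x,z$ those of the two under-arcs. It is non-trivial if it uses at least two colors; existence of a non-trivial $r$-coloring does not depend on the diagram. If $K$ admits non-trivial $r$-colorings, let $n_{D,r}$ be the least number of distinct colors used in a non-trivial $r$-coloring of a diagram $D$ of $K$, and set $\mathrm{mincol}_r(K)=\min\{n_{D,r}: D \text{ a diagram of } K\}$. An equality $\mathrm{mincol}_r(K)=k$ means that $K$ admits non-trivial $r$-colorings and this minimum equals $k$. *)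

theory Defs
  imports Main "HOL-Number_Theory.Cong"
begin

text \<open>
  Knots and links (unoriented, in 3-space) are handled combinatorially, as classes of diagrams
  modulo planar isotopy and the Reidemeister moves.

  A link diagram in the plane is put in general position with respect to the height function and
  cut into horizontal slices, read from bottom to top, each containing exactly one local minimum
  (Cup), local maximum (Cap) or crossing (Over, Under). The slice (i, g) has i vertical strands
  to the left of g, and any number of vertical strands to its right. Over is the crossing whose
  over-strand runs from bottom left to top right, Under the one whose over-strand runs from bottom
  right to top left.
\<close>

datatype piece = Cup | Cap | Over | Under

type_synonym slice = "nat \<times> piece"

fun ends_below :: "piece \<Rightarrow> nat" where
  "ends_below Cup = 0"
| "ends_below Cap = 2"
| "ends_below Over = 2"
| "ends_below Under = 2"

fun ends_above :: "piece \<Rightarrow> nat" where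
  "ends_above Cup = 2"
| "ends_above Cap = 0"
| "ends_above Over = 2"
| "ends_above Under = 2"

fun tangle :: "nat \<Rightarrow> slice list \<Rightarrow> nat \<Rightarrow> bool" where
  "tangle a [] b \<longleftrightarrow> a = b"
| "tangle a ((i, g) # w) b \<longleftrightarrow>
     i + ends_below g \<le> a \<and> tangle (a - ends_below g + ends_above g) w b"

definition diagram :: "slice list \<Rightarrow> bool" where
  "diagram D \<longleftrightarrow> tangle 0 D 0"

text \<open>
  The first four groups of moves (exchanging the heights of two distant pieces, cancelling a
  minimum against a maximum, sliding a strand through a minimum, sliding a strand through a
  maximum) generate planar isotopy of sliced diagrams; the remaining ones are the Reidemeister
  moves. The other versions of the Reidemeister moves, rotated or with other crossing
  information, are consequences of those listed.
\<close>

inductive move :: "slice list \<Rightarrow> slice list \<Rightarrow> bool" where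
  exchange:
    "move [(i, g), (i + ends_above g + k, h)] [(i + ends_below g + k, h), (i, g)]"
| zigzag_left:  "move [(i, Cup), (Suc i, Cap)] []"
| zigzag_right: "move [(Suc i, Cup), (i, Cap)] []"
| cup_slide_over:  "move [(i, Cup), (Suc i, Under)] [(Suc i, Cup), (i, Over)]"
| cup_slide_under: "move [(i, Cup), (Suc i, Over)] [(Suc i, Cup), (i, Under)]"
| cap_slide_over:  "move [(Suc i, Over), (i, Cap)] [(i, Under), (Suc i, Cap)]"
| cap_slide_under: "move [(Suc i, Under), (i, Cap)] [(i, Over), (Suc i, Cap)]"
| R1_cup_over:  "move [(i, Cup), (i, Over)] [(i, Cup)]"
| R1_cup_under: "move [(i, Cup), (i, Under)] [(i, Cup)]"
| R1_cap_over:  "move [(i, Over), (i, Cap)] [(i, Cap)]"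
| R1_cap_under: "move [(i, Under), (i, Cap)] [(i, Cap)]"
| R2_over_under: "move [(i, Over), (i, Under)] []"
| R2_under_over: "move [(i, Under), (i, Over)] []"
| R3: "move [(i, Over), (Suc i, Over), (i, Over)] [(Suc i, Over), (i, Over), (Suc i, Over)]"

text \<open>
  Requiring both sides to be diagrams guarantees that the strands taking part in a move whose
  right-hand side is empty are really there.
\<close>

definition diagram_step :: "slice list \<Rightarrow> slice list \<Rightarrow> bool" where
  "diagram_step D D' \<longleftrightarrow> diagram D \<and> diagram D' \<and>
     (\<exists>u v w w'. move w w' \<and> D = u @ w @ v \<and> D' = u @ w' @ v)"

text \<open>A link is identified with the set of all its diagrams.\<close>

type_synonym link = "slice list set"

definition link_of :: "slice list \<Rightarrow> link" where
  "link_of D = {D'. diagram D' \<and> equivclp diagram_step D D'}"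

text \<open>
  The closure of a word in crossings on the strands 0, ..., m - 1: nested cups and caps join
  strand j to the vertical return strand 2 m - 1 - j.
\<close>

definition braid_closure :: "nat \<Rightarrow> slice list \<Rightarrow> slice list" where
  "braid_closure m \<beta> = map (\<lambda>j. (j, Cup)) [0..<m] @ \<beta> @ map (\<lambda>j. (j, Cap)) (rev [0..<m])"

text \<open>
  The braid generators are indexed from 1, the strands from 0. The choice of sign and of reading
  direction does not affect THK(3,n): the mirror image of its diagram has the braid
  (sigma_2^-1 sigma_1)^n, which turns into (sigma_1^-1 sigma_2)^n, a conjugate of the original,
  by a half turn exchanging sigma_1 and sigma_2.
\<close>

definition sigma :: "nat \<Rightarrow> slice" where
  "sigma i = (i - 1, Over)"

definition sigma_inv :: "nat \<Rightarrow> slice" where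
  "sigma_inv i = (i - 1, Under)"

definition THK3_braid :: "nat \<Rightarrow> slice list" where
  "THK3_braid n = concat (replicate n [sigma 2, sigma_inv 1])"

definition THK3 :: "nat \<Rightarrow> link" where
  "THK3 n = link_of (braid_closure 3 (THK3_braid n))"

lemma diagram_THK3: "diagram (braid_closure 3 (THK3_braid n))"
proof -
  have "tangle 6 (THK3_braid n @ w) 0 \<longleftrightarrow> tangle 6 w 0" for w
    by (induction n) (auto simp: THK3_braid_def sigma_def sigma_inv_def)
  then show ?thesis
    by (simp add: diagram_def braid_closure_def upt_rec numeral_eq_Suc)
qed

text \<open>
  Elements of Z/rZ are represented by the integers 0, ..., r - 1. A coloring lists, for each of the
  levels between consecutive slices (and the two outer ones), the colors of the strands from left
  to right; the condition for the pieces makes the color constant along each arc, and imposes the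
  coloring condition at each crossing, where y is the color of the over-arc and x, z are the colors
  of the two under-arcs.
\<close>

fun piece_coloring :: "nat \<Rightarrow> piece \<Rightarrow> int list \<Rightarrow> int list \<Rightarrow> bool" where
  "piece_coloring r Cup bs ts \<longleftrightarrow> (\<exists>y. bs = [] \<and> ts = [y, y])"
| "piece_coloring r Cap bs ts \<longleftrightarrow> (\<exists>y. bs = [y, y] \<and> ts = [])"
| "piece_coloring r Over bs ts \<longleftrightarrow>
     (\<exists>x y z. bs = [y, x] \<and> ts = [z, y] \<and> [2 * y - x - z = 0] (mod int r))"
| "piece_coloring r Under bs ts \<longleftrightarrow>
     (\<exists>x y z. bs = [x, y] \<and> ts = [y, z] \<and> [2 * y - x - z = 0] (mod int r))"

fun slice_coloring :: "nat \<Rightarrow> slice \<Rightarrow> int list \<Rightarrow> int list \<Rightarrow> bool" where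
  "slice_coloring r (i, g) cs cs' \<longleftrightarrow>
     (\<exists>us vs bs ts. length us = i \<and> cs = us @ bs @ vs \<and> cs' = us @ ts @ vs \<and>
        piece_coloring r g bs ts)"

definition colors_used :: "int list list \<Rightarrow> int set" where
  "colors_used C = (\<Union>cs \<in> set C. set cs)"

definition coloring :: "nat \<Rightarrow> slice list \<Rightarrow> int list list \<Rightarrow> bool" where
  "coloring r D C \<longleftrightarrow>
     length C = Suc (length D) \<and> C ! 0 = [] \<and> colors_used C \<subseteq> {0..<int r} \<and>
     (\<forall>k < length D. slice_coloring r (D ! k) (C ! k) (C ! Suc k))"

definition nontrivial_coloring :: "nat \<Rightarrow> slice list \<Rightarrow> int list list \<Rightarrow> bool" where
  "nontrivial_coloring r D C \<longleftrightarrow> coloring r D C \<and> card (colors_used C) \<ge> 2"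

definition admits_nontrivial :: "nat \<Rightarrow> link \<Rightarrow> bool" where
  "admits_nontrivial r K \<longleftrightarrow> (\<exists>D \<in> K. \<exists>C. nontrivial_coloring r D C)"

definition min_colors_diagram :: "nat \<Rightarrow> slice list \<Rightarrow> nat" where
  "min_colors_diagram r D = (LEAST k. \<exists>C. nontrivial_coloring r D C \<and> k = card (colors_used C))"

definition mincol :: "nat \<Rightarrow> link \<Rightarrow> nat" where
  "mincol r K =
     (LEAST k. \<exists>D \<in> K. (\<exists>C. nontrivial_coloring r D C) \<and> k = min_colors_diagram r D)"

text \<open>
  The value of \<^const>\<open>mincol\<close> is meaningful only for links with nontrivial r-colorings, so the
  equation mincol r K = k is always read as follows.
\<close>

definition mincol_eq :: "nat \<Rightarrow> link \<Rightarrow> nat \<Rightarrow> bool" where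
  "mincol_eq r K k \<longleftrightarrow> admits_nontrivial r K \<and> mincol r K = k"

end

theory Submission
  imports Defs "HOL-Library.Product_Plus" "HOL-Computational_Algebra.Primes"
begin

text \<open>
  \<^bold>\<open>Colorings as a link invariant.\<close> A coloring is a sequence of color lists, one for each level, in
  which every slice forces a local rule. The same rule makes sense modulo every \<open>m\<close>, and for
  \<open>m = 0\<close> it describes colorings by integers. A move changes a coloring only inside the
  slices that it replaces and cannot make it constant, so the existence of a nonconstant coloring
  modulo \<open>m\<close>, also for \<open>m = 0\<close>, depends only on the link (\<open>nonconstant_link\<close>).

  \<^bold>\<open>The closed braid.\<close> Numbered in the order in which they are born, the arcs of the standard diagram
  of THK(3,n) have colors with \<open>s (k + 3) = 2 * s (k + 2) - s k\<close>. Hence the differences \<open>t k\<close> of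
  consecutive colors form a sequence of Fibonacci type, and closing the braid makes it periodic with
  period \<open>2 * n\<close> modulo \<open>m\<close>. As \<open>t (k + 4 * n) + t k = L * t (k + 2 * n)\<close>, where \<open>L\<close> is the Lucas
  number with index \<open>2 * n\<close>, the modulus divides \<open>(L - 2) * t k\<close>. So there are no nonconstant integer
  colorings, and a prime \<open>p\<close> with nonconstant colorings divides \<open>L - 2\<close>. For \<open>p = 2, 3, 5, 7\<close> this
  means that \<open>n\<close> is a multiple of \<open>3, 4, 2, 8\<close>.

  \<^bold>\<open>Few colors need a small prime.\<close> Let a diagram of THK(3,n) be nontrivially colored modulo \<open>r\<close> with
  \<open>k \<le> 4\<close> colors. The congruences \<open>2 * y - x - z = 0\<close> that hold among these colors, read as
  equations over the integers in \<open>k\<close> unknowns, have constant solutions only: any other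
  solution would recolor the diagram with integers. Fixing one unknown to be \<open>0\<close>, some \<open>k - 1\<close> of the
  equations therefore have a nonzero determinant. Its absolute value is at most \<open>2 ^ (k - 1)\<close>, since
  \<open>2 * y - x - z = (y - x) + (y - z)\<close> and determinants of differences of unknowns are \<open>0\<close> or
  \<open>\<plusminus>1\<close>. By Cramer's rule it annihilates all differences of colors modulo \<open>r\<close>. A prime factor \<open>p\<close> of
  the least positive annihilator divides \<open>r\<close>, is at most \<open>2 ^ (k - 1)\<close>, and yields a nonconstant
  coloring modulo \<open>p\<close> (\<open>few_colors_small_prime\<close>). Two colors thus force \<open>p = 2\<close>, three colors
  \<open>p \<le> 3\<close>, and four colors \<open>p \<le> 7\<close>.

  \<^bold>\<open>Colorings with few colors exist.\<close> A coloring modulo \<open>p\<close> becomes one modulo a multiple \<open>r\<close> of \<open>p\<close>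
  by scaling, and if a block of \<open>q\<close> periods of the braid returns to the colors from which it started,
  then the closure is colored whenever \<open>q\<close> divides \<open>n\<close> (\<open>THK3_colored_by_block\<close>). Suitable
  sequences \<open>s\<close> are the Fibonacci sequence modulo \<open>2\<close> and modulo \<open>3\<close> and the geometric sequences
  \<open>3 ^ k\<close> modulo \<open>5\<close> and \<open>4 ^ k\<close> modulo \<open>11\<close>: the ratios \<open>3\<close> and \<open>4\<close> are roots of
  \<open>X\<^sup>2 = X + 1\<close>. They take \<open>2, 3, 4, 5\<close> values. Modulo \<open>7\<close> every nonconstant sequence takes all
  seven values, and the diagram itself has to be changed: explicit chains of moves lead from eight
  periods of the braid to a tangle that starts and ends in the same colors and uses only
  \<open>0, 1, 2, 4\<close> (\<open>block8_equiv\<close>, \<open>block_follow\<close>).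
\<close>

section \<open>Colorings as sequences of levels\<close>

text \<open>
The dihedral quandle: the color of the second under-arc at a crossing with over-arc \<open>y\<close> and first
under-arc \<open>x\<close>. As \<open>a mod 0 = a\<close>, the modulus \<open>0\<close> gives the integers. The three lemmas \<open>reflect_self\<close>,
\<open>reflect_reflect\<close> and \<open>reflect_distrib\<close> are the algebraic forms of the three Reidemeister moves.
\<close>

definition reflect :: "nat \<Rightarrow> int \<Rightarrow> int \<Rightarrow> int" where
  "reflect m y x = (2 * y - x) mod int m"

lemma reflect_mod [simp]: "reflect m y x mod int m = reflect m y x"
  by (simp add: reflect_def)

lemma reflect_self [simp]: "x mod int m = x \<Longrightarrow> reflect m x x = x"
  by (simp add: reflect_def)

lemma reflect_mods: "reflect m (y mod int m) (x mod int m) = reflect m y x"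
proof -
  have "reflect m (y mod int m) (x mod int m)
      = ((2 * (y mod int m)) mod int m - x mod int m mod int m) mod int m"
    unfolding reflect_def by (rule mod_diff_eq[symmetric])
  also have "\<dots> = reflect m y x"
    unfolding reflect_def mod_mult_right_eq mod_mod_trivial by (rule mod_diff_eq)
  finally show ?thesis .
qed

lemma reflect_reflect [simp]: "x mod int m = x \<Longrightarrow> reflect m y (reflect m y x) = x"
  unfolding reflect_def mod_diff_right_eq by simp

lemma reflect_eq_iff [simp]:
  assumes "x mod int m = x" and "y mod int m = y"
  shows "reflect m y x = y \<longleftrightarrow> x = y" "y = reflect m y x \<longleftrightarrow> x = y"
  using reflect_reflect[OF assms(1), of y] reflect_self[OF assms(2)] by (metis)+

lemma reflect_distrib [simp]: "reflect m (reflect m z y) (reflect m z x) = reflect m z (reflect m y x)"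
proof -
  have "reflect m (reflect m z y) (reflect m z x) = reflect m (2 * z - y) (2 * z - x)"
    unfolding reflect_def[of m z] by (rule reflect_mods)
  also have "\<dots> = (2 * z - (2 * y - x)) mod int m"
    unfolding reflect_def by (rule arg_cong[of _ _ "\<lambda>k. k mod int m"]) simp
  also have "\<dots> = reflect m z (reflect m y x)"
    unfolding reflect_def mod_diff_right_eq ..
  finally show ?thesis .
qed

text \<open>
Colors are canonical representatives, the \<open>x\<close> with \<open>x mod int m = x\<close>, so that a crossing determines its
second under-arc. The recursion peels off the strands to the left of the piece, which keep their
colors; this reduces statements about slices to pieces at the left margin.
\<close>

fun step :: "nat \<Rightarrow> nat \<Rightarrow> piece \<Rightarrow> int list \<Rightarrow> int list \<Rightarrow> bool" where
  "step m (Suc i) g cs cs' \<longleftrightarrow> (\<exists>c ds ds'. cs = c # ds \<and> cs' = c # ds' \<and> step m i g ds ds')"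
| "step m 0 Cup cs cs' \<longleftrightarrow> (\<exists>y. y mod int m = y \<and> cs' = y # y # cs)"
| "step m 0 Cap cs cs' \<longleftrightarrow> (\<exists>y. cs = y # y # cs')"
| "step m 0 Over cs cs' \<longleftrightarrow> (\<exists>x y vs. cs = y # x # vs \<and> cs' = reflect m y x # y # vs)"
| "step m 0 Under cs cs' \<longleftrightarrow> (\<exists>x y vs. cs = x # y # vs \<and> cs' = y # reflect m y x # vs)"

text \<open>
The set \<open>U\<close> of all colors in use is an argument of the relation because the ends do not determine it.
\<close>

fun run :: "nat \<Rightarrow> slice list \<Rightarrow> int list \<Rightarrow> int set \<Rightarrow> int list \<Rightarrow> bool" where
  "run m [] cs U cs' \<longleftrightarrow> cs' = cs \<and> U = set cs"
| "run m ((i, g) # w) cs U cs' \<longleftrightarrow>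
     (\<exists>ds V. step m i g cs ds \<and> run m w ds V cs' \<and> U = set cs \<union> V)"

text \<open>
The unfolded forms with the colors of the level below spelled out. With these, the quantified
levels between the slices disappear, and statements about short words become equational.
\<close>

lemma run_base:
  "run m ((0, Cup) # w) cs U cs' \<longleftrightarrow>
     (\<exists>y V. y mod int m = y \<and> run m w (y # y # cs) V cs' \<and> U = set cs \<union> V)"
  "run m ((0, Cap) # w) cs U cs' \<longleftrightarrow>
     (\<exists>y ds V. cs = y # y # ds \<and> run m w ds V cs' \<and> U = insert y (set ds) \<union> V)"
  "run m ((0, Over) # w) cs U cs' \<longleftrightarrow>
     (\<exists>y x ds V. cs = y # x # ds \<and> run m w (reflect m y x # y # ds) V cs' \<and> U = set cs \<union> V)"
  "run m ((0, Under) # w) cs U cs' \<longleftrightarrow>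
     (\<exists>x y ds V. cs = x # y # ds \<and> run m w (y # reflect m y x # ds) V cs' \<and> U = set cs \<union> V)"
  "run m ((Suc 0, Cup) # w) cs U cs' \<longleftrightarrow>
     (\<exists>c y ds V. cs = c # ds \<and> y mod int m = y \<and> run m w (c # y # y # ds) V cs' \<and> U = set cs \<union> V)"
  "run m ((Suc 0, Cap) # w) cs U cs' \<longleftrightarrow>
     (\<exists>c y ds V. cs = c # y # y # ds \<and> run m w (c # ds) V cs' \<and> U = set cs \<union> V)"
  "run m ((Suc 0, Over) # w) cs U cs' \<longleftrightarrow>
     (\<exists>c y x ds V. cs = c # y # x # ds \<and> run m w (c # reflect m y x # y # ds) V cs' \<and> U = set cs \<union> V)"
  "run m ((Suc 0, Under) # w) cs U cs' \<longleftrightarrow>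
     (\<exists>c x y ds V. cs = c # x # y # ds \<and> run m w (c # y # reflect m y x # ds) V cs' \<and> U = set cs \<union> V)"
  by (auto; blast)+

lemma run_ends: "run m w cs U cs' \<Longrightarrow> set cs \<subseteq> U \<and> set cs' \<subseteq> U"
proof (induction w arbitrary: cs U)
  case (Cons s w)
  obtain i g where "s = (i, g)"
    by (cases s)
  with Cons.prems obtain ds V where "run m w ds V cs'" "U = set cs \<union> V"
    by auto
  with Cons.IH[of ds V] show ?case
    by blast
qed simp

lemma run_append:
  "run m (u @ v) cs U cs' \<longleftrightarrow>
     (\<exists>ds V W. run m u cs V ds \<and> run m v ds W cs' \<and> U = V \<union> W)"
proof (induction u arbitrary: cs U)
  case Nil
  have "set cs \<union> W = W" if "run m v cs W cs'" for W
    using run_ends[OF that] by blast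
  then show ?case
    unfolding append_Nil run.simps by metis
next
  case (Cons s u)
  obtain i g where "s = (i, g)"
    by (cases s)
  then show ?case
    unfolding append_Cons by (simp only: run.simps Cons.IH) blast
qed

lemma step_length:
  "step m i g cs ds \<Longrightarrow> i + ends_below g \<le> length cs \<and> length ds = length cs - ends_below g + ends_above g"
proof (induction i arbitrary: cs ds)
  case 0
  then show ?case
    by (cases g) auto
next
  case (Suc i)
  then obtain c cs0 ds0 where 1: "cs = c # cs0" "ds = c # ds0" "step m i g cs0 ds0"
    by auto
  from Suc.IH[OF 1(3)] have "i + ends_below g \<le> length cs0"
    "length ds0 = length cs0 - ends_below g + ends_above g"
    by auto
  moreover from 1(1,2) have "length cs = Suc (length cs0)" "length ds = Suc (length ds0)"
    by simp_all
  ultimately show ?case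
    by linarith
qed

lemma run_tangle: "run m w cs U cs' \<Longrightarrow> tangle (length cs) w (length cs')"
proof (induction w arbitrary: cs U)
  case (Cons s w)
  obtain i g where s: "s = (i, g)"
    by (cases s)
  with Cons.prems obtain ds V where 1: "step m i g cs ds" and "run m w ds V cs'"
    by auto
  with Cons.IH have "tangle (length ds) w (length cs')"
    by blast
  with step_length[OF 1] show ?case
    unfolding s tangle.simps by metis
qed simp

lemma step_canonical:
  "step m i g cs ds \<Longrightarrow> \<forall>x \<in> set cs. x mod int m = x \<Longrightarrow> \<forall>x \<in> set ds. x mod int m = x"
proof (induction i arbitrary: cs ds)
  case 0
  then show ?case
    by (cases g) auto
qed auto

lemma run_canonical:
  "run m w cs U cs' \<Longrightarrow> \<forall>x \<in> set cs. x mod int m = x \<Longrightarrow> \<forall>x \<in> U. x mod int m = x"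
proof (induction w arbitrary: cs U)
  case (Cons s w)
  obtain i g where s: "s = (i, g)"
    by (cases s)
  with Cons.prems obtain ds V where 1: "step m i g cs ds" "run m w ds V cs'" "U = set cs \<union> V"
    by auto
  from step_canonical[OF 1(1) Cons.prems(2)] Cons.IH[OF 1(2)] Cons.prems(2) 1(3) show ?case
    by blast
qed simp

lemma tangle_append: "tangle a (u @ v) c \<longleftrightarrow> (\<exists>b. tangle a u b \<and> tangle b v c)"
proof (induction u arbitrary: a)
  case (Cons s u)
  then show ?case
    by (cases s) (simp only: append_Cons tangle.simps, blast)
qed simp

text \<open>
A word determines the difference between the numbers of strands at its two ends. Hence the level
above a replaced factor is the same in both diagrams of a step.
\<close>

lemma tangle_source_unique: "tangle a w c \<Longrightarrow> tangle b w c \<Longrightarrow> a = b"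
proof (induction w arbitrary: a b)
  case (Cons s w)
  obtain i g where s: "s = (i, g)"
    by (cases s)
  from Cons.prems have "i + ends_below g \<le> a" "i + ends_below g \<le> b"
    "tangle (a - ends_below g + ends_above g) w c" "tangle (b - ends_below g + ends_above g) w c"
    unfolding s tangle.simps by blast+
  from Cons.IH[OF this(3,4)] this(1,2) show ?case
    by linarith
qed simp

lemma tangle_target_unique: "tangle a w b \<Longrightarrow> tangle a w c \<Longrightarrow> b = c"
proof (induction w arbitrary: a)
  case (Cons s w)
  then show ?case
    by (cases s) (simp only: tangle.simps, blast)
qed simp

text \<open>
Colorings may be pushed forward along any map that respects the coloring rule on the colors in use.
This serves to recolor with integers, to reduce to a prime, and to scale up to a multiple.
\<close>

lemma run_map:
  assumes "run m w cs U cs'"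
    and "\<And>x. x \<in> U \<Longrightarrow> f x mod int m' = f x"
    and "\<And>x y. x \<in> U \<Longrightarrow> y \<in> U \<Longrightarrow> reflect m y x \<in> U \<Longrightarrow> f (reflect m y x) = reflect m' (f y) (f x)"
  shows "run m' w (map f cs) (f ` U) (map f cs')"
proof -
  have step: "step m' i g (map f cs) (map f ds)"
    if "step m i g cs ds" "set cs \<subseteq> U" "set ds \<subseteq> U" for i g cs ds
    using that
  proof (induction i arbitrary: cs ds)
    case 0
    then show ?case
      using assms(2,3) by (cases g) auto
  qed auto
  have "run m' w (map f cs) (f ` V) (map f cs')" if "run m w cs V cs'" "V \<subseteq> U" for V
    using that
  proof (induction w arbitrary: cs V)
    case (Cons s w)
    obtain i g where s: "s = (i, g)"
      by (cases s)
    with Cons.prems obtain ds W where 1: "step m i g cs ds" "run m w ds W cs'" "V = set cs \<union> W"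
      by auto
    have "step m' i g (map f cs) (map f ds)"
      using step[OF 1(1)] run_ends[OF 1(2)] 1(3) Cons.prems(2) by blast
    moreover have "run m' w (map f ds) (f ` W) (map f cs')"
      using Cons.IH[OF 1(2)] 1(3) Cons.prems(2) by blast
    moreover have "f ` V = set (map f cs) \<union> f ` W"
      using 1(3) by auto
    ultimately show ?case
      unfolding s run.simps by blast
  qed auto
  with assms(1) show ?thesis
    by blast
qed

section \<open>Invariance under the moves\<close>

text \<open>
Colorings of \<open>w\<close> carry over to \<open>w'\<close> with the same colors at both ends. The colors inside may
change, but a coloring that becomes constant must have been constant before. The condition on
\<open>tangle\<close> provides the strands on which \<open>w'\<close> acts when \<open>w\<close> is empty.
\<close>

definition transfers :: "nat \<Rightarrow> slice list \<Rightarrow> slice list \<Rightarrow> bool" where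
  "transfers m w w' \<longleftrightarrow> (\<forall>cs U cs'. (\<forall>x \<in> set cs. x mod int m = x) \<longrightarrow>
     tangle (length cs) w' (length cs') \<longrightarrow> run m w cs U cs' \<longrightarrow>
     (\<exists>U'. run m w' cs U' cs' \<and> (\<forall>c. U' \<subseteq> {c} \<longrightarrow> U \<subseteq> {c})))"

text \<open>
An additional strand on the left. It reduces each move to the case in which the move takes place
at the left margin.
\<close>

definition shift :: "slice list \<Rightarrow> slice list" where
  "shift = map (\<lambda>(i, g). (Suc i, g))"

lemma shift_simps [simp]: "shift [] = []" "shift ((i, g) # w) = (Suc i, g) # shift w"
  by (simp_all add: shift_def)

lemma run_shift: "run m (shift w) (c # cs) U cs' \<longleftrightarrow>
   (\<exists>ds' V. cs' = c # ds' \<and> run m w cs V ds' \<and> U = insert c V)"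
proof (induction w arbitrary: c cs U)
  case (Cons s w)
  obtain i g where s: "s = (i, g)"
    by (cases s)
  show ?case
  proof
    assume "run m (shift (s # w)) (c # cs) U cs'"
    then obtain ds V where 1: "step m i g cs ds" and 2: "run m (shift w) (c # ds) V cs'"
      and U: "U = set (c # cs) \<union> V"
      by (auto simp: s)
    from 2 obtain ds' W where "cs' = c # ds'" "run m w ds W ds'" "V = insert c W"
      unfolding Cons.IH by blast
    with 1 U show "\<exists>ds' V. cs' = c # ds' \<and> run m (s # w) cs V ds' \<and> U = insert c V"
      by (intro exI[of _ ds'] exI[of _ "set cs \<union> W"]) (auto simp: s)
  next
    assume "\<exists>ds' V. cs' = c # ds' \<and> run m (s # w) cs V ds' \<and> U = insert c V"
    then obtain ds' ds W where "cs' = c # ds'" "step m i g cs ds" "run m w ds W ds'"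
      "U = insert c (set cs \<union> W)"
      by (auto simp: s)
    moreover from this have "run m (shift w) (c # ds) (insert c W) cs'"
      unfolding Cons.IH by blast
    ultimately show "run m (shift (s # w)) (c # cs) U cs'"
      by (simp add: s) blast
  qed
qed auto

lemma tangle_shift: "tangle (Suc a) (shift w) (Suc b) \<longleftrightarrow> tangle a w b"
proof (induction w arbitrary: a)
  case (Cons s w)
  obtain i g where s: "s = (i, g)"
    by (cases s)
  show ?case
  proof (cases "i + ends_below g \<le> a")
    case True
    then have eq: "Suc a - ends_below g + ends_above g = Suc (a - ends_below g + ends_above g)"
      by (simp add: Suc_diff_le)
    show ?thesis
      unfolding s shift_simps tangle.simps eq Cons.IH by (rule conj_cong) simp_all
  next
    case False
    then show ?thesis
      unfolding s shift_simps tangle.simps by simp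
  qed
qed simp

lemma transfers_shift:
  assumes "transfers m w w'" and "w \<noteq> [] \<or> w' \<noteq> []"
  shows "transfers m (shift w) (shift w')"
  unfolding transfers_def
proof (intro allI impI)
  fix cs U cs'
  assume 1: "\<forall>x\<in>set cs. x mod int m = x" and 2: "tangle (length cs) (shift w') (length cs')"
    and 3: "run m (shift w) cs U cs'"
  have "cs \<noteq> []"
  proof
    assume "cs = []"
    with 3 have "w = []"
      by (cases w) auto
    moreover from 2 \<open>cs = []\<close> have "w' = []"
      by (cases w') auto
    ultimately show False
      using assms(2) by simp
  qed
  then obtain c ds where cs: "cs = c # ds" by (cases cs) auto
  with 3 obtain ds' V where cs': "cs' = c # ds'" and V: "run m w ds V ds'" and U: "U = insert c V"
    by (auto simp: run_shift)
  from 1 have "\<forall>x\<in>set ds. x mod int m = x"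
    by (simp add: cs)
  moreover from 2 have "tangle (length ds) w' (length ds')"
    by (simp add: cs cs' tangle_shift)
  ultimately obtain V' where V': "run m w' ds V' ds'" "\<forall>c. V' \<subseteq> {c} \<longrightarrow> V \<subseteq> {c}"
    using assms(1) V unfolding transfers_def by blast
  then show "\<exists>U'. run m (shift w') cs U' cs' \<and> (\<forall>c. U' \<subseteq> {c} \<longrightarrow> U \<subseteq> {c})"
    by (intro exI[of _ "insert c V'"]) (simp only: run_shift cs cs' U, blast)
qed

definition interchangeable :: "nat \<Rightarrow> slice list \<Rightarrow> slice list \<Rightarrow> bool" where
  "interchangeable m w w' \<longleftrightarrow> transfers m w w' \<and> transfers m w' w"

lemma interchangeable_shift:
  "interchangeable m w w' \<Longrightarrow> w \<noteq> [] \<or> w' \<noteq> [] \<Longrightarrow> interchangeable m (shift w) (shift w')"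
  by (auto simp: interchangeable_def intro: transfers_shift)

lemma interchangeable_exchange:
  "interchangeable m [(0, g), (ends_above g + k, h)] [(ends_below g + k, h), (0, g)]"
  unfolding interchangeable_def transfers_def
  by (cases g; simp; intro conjI allI impI; auto simp: run_base; blast)

lemma interchangeable_raise:
  assumes "interchangeable m w w'" and "w \<noteq> []"
  shows "interchangeable m (map (apfst ((+) i)) w) (map (apfst ((+) i)) w')"
proof (induction i)
  case (Suc i)
  have *: "map (apfst ((+) (Suc i))) v = shift (map (apfst ((+) i)) v)" for v :: "slice list"
    by (auto simp: shift_def)
  show ?case
    unfolding * using assms(2) by (intro interchangeable_shift Suc) auto
qed (use assms(1) in \<open>simp add: apfst_def map_prod_def\<close>)

text \<open>
In each case the colors inside are determined by those at the ends, and the two sides agree by the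
quandle laws.
\<close>

lemma interchangeable_base:
  "interchangeable m [(0, Cup), (Suc 0, Cap)] []"
  "interchangeable m [(Suc 0, Cup), (0, Cap)] []"
  "interchangeable m [(0, Cup), (Suc 0, Under)] [(Suc 0, Cup), (0, Over)]"
  "interchangeable m [(0, Cup), (Suc 0, Over)] [(Suc 0, Cup), (0, Under)]"
  "interchangeable m [(Suc 0, Over), (0, Cap)] [(0, Under), (Suc 0, Cap)]"
  "interchangeable m [(Suc 0, Under), (0, Cap)] [(0, Over), (Suc 0, Cap)]"
  "interchangeable m [(0, Cup), (0, Over)] [(0, Cup)]"
  "interchangeable m [(0, Cup), (0, Under)] [(0, Cup)]"
  "interchangeable m [(0, Over), (0, Cap)] [(0, Cap)]"
  "interchangeable m [(0, Under), (0, Cap)] [(0, Cap)]"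
  "interchangeable m [(0, Over), (0, Under)] []"
  "interchangeable m [(0, Under), (0, Over)] []"
  "interchangeable m [(0, Over), (Suc 0, Over), (0, Over)] [(Suc 0, Over), (0, Over), (Suc 0, Over)]"
  unfolding interchangeable_def transfers_def
  by (auto simp: run_base Suc_le_length_iff numeral_eq_Suc simp del: run.simps(2))

lemma interchangeable_move: "move w w' \<Longrightarrow> interchangeable m w w'"
proof (induction rule: move.induct)
  case (exchange i g k h)
  show ?case
    using interchangeable_raise[OF interchangeable_exchange[of m g k h], of i] by (simp add: add.assoc)
qed (use interchangeable_base[THEN interchangeable_raise, of m] in simp_all)

definition nonconstant :: "nat \<Rightarrow> slice list \<Rightarrow> bool" where
  "nonconstant m D \<longleftrightarrow> (\<exists>U. run m D [] U [] \<and> (\<forall>c. \<not> U \<subseteq> {c}))"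

lemma nonconstant_replace:
  assumes "transfers m w w'" and "diagram (u @ w' @ v)" and "nonconstant m (u @ w @ v)"
  shows "nonconstant m (u @ w' @ v)"
proof -
  from assms(3) obtain cs ds V1 V2 V3 where 1: "run m u [] V1 cs" "run m w cs V2 ds" "run m v ds V3 []"
    and nc: "\<forall>c. \<not> V1 \<union> (V2 \<union> V3) \<subseteq> {c}"
    by (auto simp: nonconstant_def run_append)
  from assms(2) obtain a b where 2: "tangle 0 u a" "tangle a w' b" "tangle b v 0"
    by (auto simp: diagram_def tangle_append)
  have "tangle 0 u (length cs)" "tangle (length ds) v 0"
    using run_tangle[OF 1(1)] run_tangle[OF 1(3)] by simp_all
  with 2 have "tangle (length cs) w' (length ds)"
    using tangle_source_unique tangle_target_unique by metis
  moreover have "\<forall>x \<in> set cs. x mod int m = x"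
    using run_canonical[OF 1(1)] run_ends[OF 1(1)] by auto
  ultimately obtain W where "run m w' cs W ds" "\<forall>c. W \<subseteq> {c} \<longrightarrow> V2 \<subseteq> {c}"
    using assms(1) 1(2) unfolding transfers_def by blast
  with 1(1,3) nc have "run m (u @ w' @ v) [] (V1 \<union> (W \<union> V3)) [] \<and> (\<forall>c. \<not> V1 \<union> (W \<union> V3) \<subseteq> {c})"
    unfolding run_append by blast
  then show ?thesis
    unfolding nonconstant_def by blast
qed

lemma nonconstant_diagram_step: "diagram_step D D' \<Longrightarrow> nonconstant m D \<longleftrightarrow> nonconstant m D'"
  using interchangeable_move nonconstant_replace
  unfolding diagram_step_def interchangeable_def by metis

text \<open>
The case \<open>m = 0\<close> covers diagrams in which components of different colors never meet, as these could
also be colored with arbitrary integers.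
\<close>

lemma nonconstant_link: "D' \<in> link_of D \<Longrightarrow> nonconstant m D' \<longleftrightarrow> nonconstant m D"
proof -
  assume "D' \<in> link_of D"
  then have "equivclp diagram_step D D'"
    by (simp add: link_of_def)
  then show ?thesis
    by (induction rule: equivclp_induct) (auto dest: nonconstant_diagram_step)
qed

section \<open>Colorings and runs\<close>

lemma residue_iff_canonical: "r > 0 \<Longrightarrow> x \<in> {0..<int r} \<longleftrightarrow> x mod int r = x"
  by (metis atLeastLessThan_iff mod_pos_pos_trivial of_nat_0_less_iff pos_mod_bound pos_mod_sign)

lemma crossing_condition_iff:
  assumes "z mod int r = z"
  shows "[2 * y - x - z = 0] (mod int r) \<longleftrightarrow> z = reflect r y x"
proof -
  have "[2 * y - x - z = 0] (mod int r) \<longleftrightarrow> [2 * y - x = z] (mod int r)"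
    by (simp add: cong_iff_dvd_diff)
  then show ?thesis
    using assms by (auto simp: cong_def reflect_def)
qed

lemma piece_coloring_imp_step:
  assumes "piece_coloring r g bs ts" and "\<forall>x \<in> set ts. x mod int r = x"
  shows "step r 0 g (bs @ vs) (ts @ vs)"
proof (cases g)
  case Over
  with assms obtain x y z where "bs = [y, x]" "ts = [z, y]" "[2 * y - x - z = 0] (mod int r)"
    by auto
  with assms(2) show ?thesis
    by (simp add: Over crossing_condition_iff)
next
  case Under
  with assms obtain x y z where "bs = [x, y]" "ts = [y, z]" "[2 * y - x - z = 0] (mod int r)"
    by auto
  with assms(2) show ?thesis
    by (simp add: Under crossing_condition_iff)
qed (use assms in auto)

lemma step_imp_piece_coloring:
  assumes "step r 0 g cs cs'"
  shows "\<exists>bs ts vs. cs = bs @ vs \<and> cs' = ts @ vs \<and> piece_coloring r g bs ts"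
proof (cases g)
  case Cup
  with assms obtain y where "cs' = y # y # cs"
    by auto
  then show ?thesis
    by (intro exI[of _ "[]"] exI[of _ "[y, y]"] exI[of _ cs]) (simp add: Cup)
next
  case Cap
  with assms obtain y where "cs = y # y # cs'"
    by auto
  then show ?thesis
    by (intro exI[of _ "[y, y]"] exI[of _ "[]"] exI[of _ cs']) (simp add: Cap)
next
  case Over
  with assms obtain x y vs where "cs = y # x # vs" "cs' = reflect r y x # y # vs"
    by auto
  then show ?thesis
    by (intro exI[of _ "[y, x]"] exI[of _ "[reflect r y x, y]"] exI[of _ vs])
      (simp add: Over crossing_condition_iff)
next
  case Under
  with assms obtain x y vs where "cs = x # y # vs" "cs' = y # reflect r y x # vs"
    by auto
  then show ?thesis
    by (intro exI[of _ "[x, y]"] exI[of _ "[y, reflect r y x]"] exI[of _ vs])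
      (simp add: Under crossing_condition_iff)
qed

lemma step_append: "step m i g (us @ cs) (us @ cs') \<longleftrightarrow> step m 0 g cs cs'" if "length us = i"
  using that by (induction us arbitrary: i) auto

lemma step_split:
  "step m i g cs cs' \<Longrightarrow>
     \<exists>us ds ds'. length us = i \<and> cs = us @ ds \<and> cs' = us @ ds' \<and> step m 0 g ds ds'"
proof (induction i arbitrary: cs cs')
  case (Suc i)
  then obtain c ds ds' where c: "cs = c # ds" "cs' = c # ds'" "step m i g ds ds'"
    by auto
  from Suc.IH[OF c(3)] obtain us es es' where
    "length us = i" "ds = us @ es" "ds' = us @ es'" "step m 0 g es es'"
    by blast
  with c show ?case
    by (intro exI[of _ "c # us"] exI[of _ es] exI[of _ es']) simp
qed auto

lemma slice_coloring_iff_step: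
  assumes "\<forall>x \<in> set cs'. x mod int r = x"
  shows "slice_coloring r (i, g) cs cs' \<longleftrightarrow> step r i g cs cs'"
proof
  assume "slice_coloring r (i, g) cs cs'"
  then obtain us vs bs ts where 1: "length us = i" "cs = us @ bs @ vs" "cs' = us @ ts @ vs"
    "piece_coloring r g bs ts"
    by auto
  with assms have "step r 0 g (bs @ vs) (ts @ vs)"
    by (intro piece_coloring_imp_step) auto
  with 1 show "step r i g cs cs'"
    by (simp only: step_append)
next
  assume "step r i g cs cs'"
  from step_split[OF this] obtain us ds ds' where 1: "length us = i" "cs = us @ ds"
    "cs' = us @ ds'" "step r 0 g ds ds'"
    by blast
  from step_imp_piece_coloring[OF 1(4)] 1(1-3) show "slice_coloring r (i, g) cs cs'"
    unfolding slice_coloring.simps by blast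
qed

text \<open>
For canonical colors the congruence at a crossing determines the second under-arc. So the colorings of
a diagram are the runs from the empty level to the empty level.
\<close>

lemma levels_imp_run:
  assumes "length C = Suc (length w)" and "\<forall>x \<in> colors_used C. x mod int r = x"
    and "\<forall>k < length w. slice_coloring r (w ! k) (C ! k) (C ! Suc k)"
  shows "run r w (hd C) (colors_used C) (last C)"
  using assms
proof (induction w arbitrary: C)
  case Nil
  then obtain cs where "C = [cs]"
    by (auto simp: length_Suc_conv)
  then show ?case
    by (simp add: colors_used_def)
next
  case (Cons s w)
  then obtain cs ds C' where C: "C = cs # ds # C'"
    by (auto simp: length_Suc_conv)
  obtain i g where s: "s = (i, g)"
    by (cases s)
  have "run r w (hd (ds # C')) (colors_used (ds # C')) (last (ds # C'))"
    using Cons.prems by (intro Cons.IH) (auto simp: C colors_used_def dest: spec[of _ "Suc _"])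
  then have "run r w ds (colors_used (ds # C')) (last C)"
    by (simp add: C)
  moreover have "slice_coloring r (i, g) cs ds"
    using Cons.prems(3) by (auto simp: C s dest: spec[of _ 0])
  then have "step r i g cs ds"
    using Cons.prems(2) by (subst (asm) slice_coloring_iff_step) (auto simp: C colors_used_def)
  moreover have "colors_used C = set cs \<union> colors_used (ds # C')" "hd C = cs"
    by (simp_all add: C colors_used_def)
  ultimately show ?case
    unfolding s run.simps by blast
qed

lemma run_imp_levels:
  assumes "run r w cs U cs'" and "\<forall>x \<in> set cs. x mod int r = x"
  shows "\<exists>C. length C = Suc (length w) \<and> C ! 0 = cs \<and> colors_used C = U \<and>
    (\<forall>k < length w. slice_coloring r (w ! k) (C ! k) (C ! Suc k))"
  using assms
proof (induction w arbitrary: cs U)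
  case Nil
  then show ?case
    by (intro exI[of _ "[cs]"]) (simp add: colors_used_def)
next
  case (Cons s w)
  obtain i g where s: "s = (i, g)"
    by (cases s)
  with Cons.prems obtain ds V where 1: "step r i g cs ds" "run r w ds V cs'" "U = set cs \<union> V"
    by auto
  from step_canonical[OF 1(1) Cons.prems(2)] have ds: "\<forall>x \<in> set ds. x mod int r = x" .
  from Cons.IH[OF 1(2) this] obtain C where C: "length C = Suc (length w)" "C ! 0 = ds"
    "colors_used C = V" "\<forall>k < length w. slice_coloring r (w ! k) (C ! k) (C ! Suc k)"
    by blast
  have "slice_coloring r s cs ds"
    using 1(1) slice_coloring_iff_step[OF ds] by (simp add: s del: slice_coloring.simps)
  with C 1(3) show ?case
    by (intro exI[of _ "cs # C"])
      (auto simp: colors_used_def nth_Cons less_Suc_eq_0_disj simp del: slice_coloring.simps split: nat.split)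
qed

lemma coloring_imp_run:
  assumes "coloring r D C" and "diagram D" and "r > 0"
  shows "run r D [] (colors_used C) []"
proof -
  from assms(1) have C: "length C = Suc (length D)" "C ! 0 = []"
    "colors_used C \<subseteq> {0..<int r}" "\<forall>k < length D. slice_coloring r (D ! k) (C ! k) (C ! Suc k)"
    by (auto simp: coloring_def)
  then have "hd C = []"
    by (cases C) auto
  with levels_imp_run[OF C(1) _ C(4)] C(3) residue_iff_canonical[OF assms(3)]
  have 1: "run r D [] (colors_used C) (last C)"
    by (metis subsetD)
  with run_tangle[OF this] assms(2) have "last C = []"
    using tangle_target_unique[of 0 D 0 "length (last C)"] by (simp add: diagram_def)
  with 1 show ?thesis
    by simp
qed

lemma run_imp_coloring:
  assumes "run r D [] U []" and "r > 0"
  shows "\<exists>C. coloring r D C \<and> colors_used C = U"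
  using run_imp_levels[OF assms(1)] run_canonical[OF assms(1)] residue_iff_canonical[OF assms(2)]
  unfolding coloring_def by (auto 4 4)

section \<open>Colorings with few colors\<close>

fun dot :: "int \<times> int \<times> int \<Rightarrow> int \<times> int \<times> int \<Rightarrow> int" where
  "dot (a, b, c) (x, y, z) = a * x + b * y + c * z"

fun cross :: "int \<times> int \<times> int \<Rightarrow> int \<times> int \<times> int \<Rightarrow> int \<times> int \<times> int" where
  "cross (a, b, c) (x, y, z) = (b * z - c * y, c * x - a * z, a * y - b * x)"

definition det3 where "det3 u v w = dot (cross u v) w"

lemma det3_add:
  "det3 (u + u') v w = det3 u v w + det3 u' v w"
  "det3 u (v + v') w = det3 u v w + det3 u v' w"
  "det3 u v (w + w') = det3 u v w + det3 u v w'"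
  by (cases u; cases u'; cases v; cases v'; cases w; cases w'; simp add: det3_def algebra_simps)+

text \<open>
The differences of two of the vectors \<open>0, e\<^sub>1, e\<^sub>2, e\<^sub>3\<close>: the columns of a reduced incidence matrix of
the complete graph on four vertices, which is totally unimodular.
\<close>

definition edge_vectors :: "(int \<times> int \<times> int) list" where
  "edge_vectors = (let E = [(0, 0, 0), (1, 0, 0), (0, 1, 0), (0, 0, 1)] in [a - b. a \<leftarrow> E, b \<leftarrow> E])"

text \<open>
Total unimodularity, by inspection of all triples.
\<close>

lemma det3_edges:
  assumes "u \<in> set edge_vectors" "v \<in> set edge_vectors" "w \<in> set edge_vectors"
  shows "\<bar>det3 u v w\<bar> \<le> 1"
proof -
  have "\<forall>u \<in> set edge_vectors. \<forall>v \<in> set edge_vectors. \<forall>w \<in> set edge_vectors. \<bar>det3 u v w\<bar> \<le> 1"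
    by code_simp
  with assms show ?thesis
    by blast
qed

abbreviation "e\<^sub>2 \<equiv> (0, 1, 0) :: int \<times> int \<times> int"
abbreviation "e\<^sub>3 \<equiv> (0, 0, 1) :: int \<times> int \<times> int"

text \<open>
Rows that are sums of two edge vectors: expanding by multilinearity leaves \<open>2\<close>, \<open>4\<close> or \<open>8\<close> determinants
of edge vectors. In dimensions one and two the missing rows are filled up with unit vectors.
\<close>

lemma det3_bounds:
  assumes "set [u, u', v, v', w, w'] \<subseteq> set edge_vectors"
  shows "\<bar>det3 (u + u') e\<^sub>2 e\<^sub>3\<bar> \<le> 2" "\<bar>det3 (u + u') (v + v') e\<^sub>3\<bar> \<le> 4"
    "\<bar>det3 (u + u') (v + v') (w + w')\<bar> \<le> 8"
proof -
  have "{e\<^sub>2, e\<^sub>3} \<subseteq> set edge_vectors"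
    by code_simp
  then have *: "\<bar>det3 a b c\<bar> \<le> 1" if "{a, b, c} \<subseteq> set [u, u', v, v', w, w', e\<^sub>2, e\<^sub>3]" for a b c
    using that assms by (intro det3_edges) auto
  show "\<bar>det3 (u + u') e\<^sub>2 e\<^sub>3\<bar> \<le> 2"
    unfolding det3_add using *[of u "e\<^sub>2" "e\<^sub>3"] *[of u' "e\<^sub>2" "e\<^sub>3"] by simp
  show "\<bar>det3 (u + u') (v + v') e\<^sub>3\<bar> \<le> 4"
    unfolding det3_add
    using *[of u v "e\<^sub>3"] *[of u v' "e\<^sub>3"] *[of u' v "e\<^sub>3"] *[of u' v' "e\<^sub>3"] by simp
  show "\<bar>det3 (u + u') (v + v') (w + w')\<bar> \<le> 8"
    unfolding det3_add
    using *[of u v w] *[of u v w'] *[of u v' w] *[of u v' w']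
      *[of u' v w] *[of u' v w'] *[of u' v' w] *[of u' v' w'] by simp
qed

lemma row_exists:
  assumes "\<exists>u \<in> R. dot u (1, 0, 0) \<noteq> 0"
  shows "\<exists>u \<in> R. det3 u e\<^sub>2 e\<^sub>3 \<noteq> 0"
proof -
  have "det3 u e\<^sub>2 e\<^sub>3 = dot u (1, 0, 0)" for u
    by (cases u) (simp add: det3_def)
  with assms show ?thesis
    by simp
qed

text \<open>
If \<open>u\<close> has the entries \<open>a\<close> and \<open>b\<close>, the vector \<open>(- b, a, 0)\<close> is orthogonal to \<open>u\<close>. A row that is not
orthogonal to this vector is independent of \<open>u\<close>.
\<close>

lemma two_rows_exist:
  assumes "\<And>x y. (x, y) \<noteq> (0, 0) \<Longrightarrow> \<exists>u \<in> R. dot u (x, y, 0) \<noteq> 0"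
  shows "\<exists>u \<in> R. \<exists>v \<in> R. det3 u v e\<^sub>3 \<noteq> 0"
proof -
  obtain u where u: "u \<in> R" "dot u (1, 0, 0) \<noteq> 0"
    using assms[of 1 0] by (metis one_neq_zero prod.inject)
  obtain a b c where abc: "u = (a, b, c)"
    by (cases u)
  with u have "a \<noteq> 0"
    by simp
  then obtain v where v: "v \<in> R" "dot v (- b, a, 0) \<noteq> 0"
    using assms[of "- b" a] by (metis prod.inject)
  have "det3 u v e\<^sub>3 = dot v (- b, a, 0)"
    by (cases v) (simp add: abc det3_def)
  with u(1) v show ?thesis
    by metis
qed

text \<open>
The same step once more, with the cross product of two independent rows as the test vector.
\<close>

lemma three_rows_exist:
  assumes "\<And>t. t \<noteq> (0, 0, 0) \<Longrightarrow> \<exists>u \<in> R. dot u t \<noteq> 0"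
  shows "\<exists>u \<in> R. \<exists>v \<in> R. \<exists>w \<in> R. det3 u v w \<noteq> 0"
proof -
  obtain u v where uv: "u \<in> R" "v \<in> R" "det3 u v e\<^sub>3 \<noteq> 0"
    using two_rows_exist[of R] assms by (metis prod.inject)
  then have "cross u v \<noteq> (0, 0, 0)"
    by (auto simp: det3_def)
  then obtain w where "w \<in> R" "dot w (cross u v) \<noteq> 0"
    using assms by blast
  moreover have "dot w (cross u v) = det3 u v w"
    by (cases w; cases "cross u v") (simp add: det3_def mult.commute)
  ultimately show ?thesis
    using uv(1,2) by auto
qed

lemma cramer:
  assumes "r dvd dot u t" "r dvd dot v t" "r dvd dot w t"
  shows "\<exists>x y z. t = (x, y, z) \<and> r dvd det3 u v w * x \<and> r dvd det3 u v w * y \<and> r dvd det3 u v w * z"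
proof -
  obtain x y z where t: "t = (x, y, z)"
    by (cases t)
  obtain a1 a2 a3 b1 b2 b3 c1 c2 c3 where uvw: "u = (a1, a2, a3)" "v = (b1, b2, b3)" "w = (c1, c2, c3)"
    by (cases u; cases v; cases w) blast
  have "det3 u v w * x = dot u t * (b2 * c3 - b3 * c2) + dot v t * (c2 * a3 - c3 * a2) + dot w t * (a2 * b3 - a3 * b2)"
    "det3 u v w * y = dot u t * (b3 * c1 - b1 * c3) + dot v t * (c3 * a1 - c1 * a3) + dot w t * (a3 * b1 - a1 * b3)"
    "det3 u v w * z = dot u t * (b1 * c2 - b2 * c1) + dot v t * (c1 * a2 - c2 * a1) + dot w t * (a1 * b2 - a2 * b1)"
    by (simp_all add: t uvw det3_def algebra_simps)
  with assms show ?thesis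
    by (auto simp: t)
qed

text \<open>
A set \<open>S\<close> of colors modulo \<open>r\<close> whose relations admit constant integer solutions only. The color \<open>x\<close>
is the unknown at position \<open>e x\<close> of a vector, with \<open>s\<^sub>0\<close> as the unknown that is fixed to be \<open>0\<close>, and
\<open>\<tau>\<close> is the vector of the actual differences of colors, which solves all relations modulo \<open>r\<close>.
\<close>

locale rigid_colors =
  fixes r :: nat and S :: "int set" and s\<^sub>0 :: int and e :: "int \<Rightarrow> int \<times> int \<times> int" and \<tau>
  assumes rigid: "\<And>f :: int \<Rightarrow> int. (\<And>x y. x \<in> S \<Longrightarrow> y \<in> S \<Longrightarrow> reflect r y x \<in> S \<Longrightarrow> f (reflect r y x) = 2 * f y - f x)
      \<Longrightarrow> \<exists>c. \<forall>x \<in> S. f x = c"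
    and s0: "s\<^sub>0 \<in> S" "e s\<^sub>0 = (0, 0, 0)"
    and e: "\<And>x. x \<in> S \<Longrightarrow> e x \<in> {(0, 0, 0), (1, 0, 0), (0, 1, 0), (0, 0, 1)}"
    and \<tau>: "\<And>x. x \<in> S \<Longrightarrow> dot (e x) \<tau> = x - s\<^sub>0"
begin

definition rows :: "(int \<times> int \<times> int) set" where
  "rows = {(e y - e x) + (e y - e z) | x y z. x \<in> S \<and> y \<in> S \<and> z \<in> S \<and> z = reflect r y x}"

lemma row_sum: "u \<in> rows \<Longrightarrow> \<exists>a \<in> set edge_vectors. \<exists>b \<in> set edge_vectors. u = a + b"
proof -
  assume "u \<in> rows"
  then obtain x y z where S: "x \<in> S" "y \<in> S" "z \<in> S" and u: "u = (e y - e x) + (e y - e z)"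
    unfolding rows_def by blast
  have "e a - e b \<in> set edge_vectors" if "a \<in> S" "b \<in> S" for a b
    using e[OF that(1)] e[OF that(2)] by (auto simp: edge_vectors_def)
  with S u show ?thesis
    by blast
qed

lemma dot_row: "dot ((e y - e x) + (e y - e z)) t = 2 * dot (e y) t - dot (e x) t - dot (e z) t"
  by (cases "e x"; cases "e y"; cases "e z"; cases t) (simp add: algebra_simps)

lemma row_annihilates: "u \<in> rows \<Longrightarrow> int r dvd dot u \<tau>"
proof -
  assume "u \<in> rows"
  then obtain x y z where S: "x \<in> S" "y \<in> S" "z \<in> S" and z: "z = reflect r y x"
    and u: "u = (e y - e x) + (e y - e z)"
    unfolding rows_def by blast
  have "dot u \<tau> = (2 * y - x) - (2 * y - x) mod int r"
    using S by (simp add: u dot_row \<tau> z reflect_def)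
  then show ?thesis
    by simp
qed

text \<open>
A vector \<open>t\<close> orthogonal to all rows is an integer solution \<open>x \<mapsto> dot (e x) t\<close> of the relations. By
rigidity it is constant, and its value at \<open>s\<^sub>0\<close> is \<open>0\<close>.
\<close>

lemma row_detects:
  assumes "x \<in> S" and "dot (e x) t \<noteq> 0"
  shows "\<exists>u \<in> rows. dot u t \<noteq> 0"
proof (rule ccontr)
  assume *: "\<not> ?thesis"
  have "\<exists>c. \<forall>x \<in> S. dot (e x) t = c"
  proof (rule rigid)
    fix x y assume "x \<in> S" "y \<in> S" "reflect r y x \<in> S"
    then have "(e y - e x) + (e y - e (reflect r y x)) \<in> rows"
      unfolding rows_def by blast
    with * have "dot ((e y - e x) + (e y - e (reflect r y x))) t = 0"
      by blast
    then show "dot (e (reflect r y x)) t = 2 * dot (e y) t - dot (e x) t"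
      unfolding dot_row by simp
  qed
  with s0 assms show False
    by (cases t) (metis dot.simps add.right_neutral mult_zero_left)
qed

lemma annihilator:
  assumes "int r dvd dot u \<tau>" "int r dvd dot v \<tau>" "int r dvd dot w \<tau>" and "x \<in> S"
  shows "int r dvd \<bar>det3 u v w\<bar> * (x - s\<^sub>0)"
  using cramer[OF assms(1-3)] e[OF assms(4)] \<tau>[OF assms(4)] by (auto simp: abs_if)

end

text \<open>
Both the determinant and its bound come from choosing as many rows as there are unknowns, which is
\<open>card S - 1\<close>. The three cases differ only in the dimension.
\<close>

lemma annihilator_exists:
  assumes rigid: "\<And>f :: int \<Rightarrow> int. (\<And>x y. x \<in> S \<Longrightarrow> y \<in> S \<Longrightarrow> reflect r y x \<in> S \<Longrightarrow> f (reflect r y x) = 2 * f y - f x)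
      \<Longrightarrow> \<exists>c. \<forall>x \<in> S. f x = c"
    and "card S \<in> {2, 3, 4}"
  shows "\<exists>d. 0 < d \<and> d \<le> 2 ^ (card S - 1) \<and> (\<exists>s \<in> S. \<forall>x \<in> S. int r dvd d * (x - s))"
proof -
  consider "card S = 2" | "card S = 3" | "card S = 4"
    using assms(2) by blast
  then show ?thesis
  proof cases
    case 1
    then obtain s a where S: "S = {s, a}" "s \<noteq> a"
      by (auto simp: card_2_iff)
    define E :: "int \<Rightarrow> int \<times> int \<times> int" where
      "E x = (of_bool (x = a), 0, 0)" for x
    interpret rigid_colors r S s E "(a - s, 0, 0)"
      by (unfold_locales, fact rigid) (use S in \<open>auto simp: E_def\<close>)
    have "\<exists>u \<in> rows. dot u (1, 0, 0) \<noteq> 0"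
      by (rule row_detects[of a]) (auto simp: S E_def)
    from row_exists[OF this] obtain u where u: "u \<in> rows" "det3 u e\<^sub>2 e\<^sub>3 \<noteq> 0"
      by blast
    have "\<bar>det3 u e\<^sub>2 e\<^sub>3\<bar> \<le> 2"
      using row_sum[OF u(1)] det3_bounds(1) by force
    moreover have "int r dvd \<bar>det3 u e\<^sub>2 e\<^sub>3\<bar> * (x - s)" if "x \<in> S" for x
      using u(1) that by (intro annihilator) (auto intro: row_annihilates)
    ultimately show ?thesis
      using u(2) 1 s0(1) by (intro exI[of _ "\<bar>det3 u e\<^sub>2 e\<^sub>3\<bar>"]) auto
  next
    case 2
    then obtain s a b where S: "S = {s, a, b}" "s \<noteq> a" "s \<noteq> b" "a \<noteq> b"
      by (auto simp: card_3_iff)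
    define E :: "int \<Rightarrow> int \<times> int \<times> int" where
      "E x = (of_bool (x = a), of_bool (x = b), 0)" for x
    interpret rigid_colors r S s E "(a - s, b - s, 0)"
      by (unfold_locales, fact rigid) (use S in \<open>auto simp: E_def\<close>)
    have "\<exists>u \<in> rows. dot u (x, y, 0) \<noteq> 0" if "(x, y) \<noteq> (0, 0)" for x y
      using that row_detects[of a "(x, y, 0)"] row_detects[of b "(x, y, 0)"] S by (auto simp: E_def)
    from two_rows_exist[OF this] obtain u v where
      uv: "u \<in> rows" "v \<in> rows" "det3 u v e\<^sub>3 \<noteq> 0"
      by blast
    have "\<bar>det3 u v e\<^sub>3\<bar> \<le> 4"
      using row_sum[OF uv(1)] row_sum[OF uv(2)] det3_bounds(2) by force
    moreover have "int r dvd \<bar>det3 u v e\<^sub>3\<bar> * (x - s)" if "x \<in> S" for x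
      using uv(1,2) that by (intro annihilator) (auto intro: row_annihilates)
    ultimately show ?thesis
      using uv(3) 2 s0(1) by (intro exI[of _ "\<bar>det3 u v e\<^sub>3\<bar>"]) auto
  next
    case 3
    then obtain s S' where S': "S = insert s S'" "s \<notin> S'" "card S' = 3"
      using card_Suc_eq[of S 3] by auto
    then obtain a b c where "S' = {a, b, c}" "a \<noteq> b" "b \<noteq> c" "a \<noteq> c"
      by (auto simp: card_3_iff)
    with S' have S: "S = {s, a, b, c}" "s \<noteq> a" "s \<noteq> b" "s \<noteq> c" "a \<noteq> b" "b \<noteq> c" "a \<noteq> c"
      by auto
    define E :: "int \<Rightarrow> int \<times> int \<times> int" where
      "E x = (of_bool (x = a), of_bool (x = b), of_bool (x = c))" for x
    interpret rigid_colors r S s E "(a - s, b - s, c - s)"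
      by (unfold_locales, fact rigid) (use S in \<open>auto simp: E_def\<close>)
    have "\<exists>u \<in> rows. dot u t \<noteq> 0" if "t \<noteq> (0, 0, 0)" for t
      using that row_detects[of a t] row_detects[of b t] row_detects[of c t] S
      by (cases t) (auto simp: E_def)
    from three_rows_exist[OF this] obtain u v w where
      uvw: "u \<in> rows" "v \<in> rows" "w \<in> rows" "det3 u v w \<noteq> 0"
      by blast
    have "\<bar>det3 u v w\<bar> \<le> 8"
      using row_sum[OF uvw(1)] row_sum[OF uvw(2)] row_sum[OF uvw(3)] det3_bounds(3) by force
    moreover have "int r dvd \<bar>det3 u v w\<bar> * (x - s)" if "x \<in> S" for x
      using uvw(1-3) that by (intro annihilator) (auto intro: row_annihilates)
    ultimately show ?thesis
      using uvw(4) 3 s0(1) by (intro exI[of _ "\<bar>det3 u v w\<bar>"]) auto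
  qed
qed

text \<open>
The least positive \<open>d\<close> that annihilates the differences of colors modulo \<open>r\<close> is a divisor of \<open>r\<close> and
bounded by the determinant found before. Dividing the multiples \<open>d * (x - s)\<close> by \<open>r\<close> gives a
coloring modulo \<open>d\<close>, and by the minimality of \<open>d\<close> it stays nonconstant modulo each prime factor of \<open>d\<close>.
\<close>

lemma few_colors_small_prime:
  fixes r :: nat
  assumes "run r D [] S []" and "\<not> nonconstant 0 D" and "card S \<in> {2, 3, 4}" and "r > 0"
  shows "\<exists>p. prime p \<and> p dvd r \<and> p \<le> 2 ^ (card S - 1) \<and> nonconstant p D"
proof -
  text \<open>
    if f:
INLINE
  \<comment> \<open>An integer solution of the relations among the colors recolors the diagram with integers.\<close>
\<close>

have "\<exists>c. \<forall>x \<in> S. f x = c"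
    if f: "\<And>x y. x \<in> S \<Longrightarrow> y \<in> S \<Longrightarrow> reflect r y x \<in> S \<Longrightarrow> f (reflect r y x) = 2 * f y - f x" for f :: "int \<Rightarrow> int"
  proof -
    have "run 0 D (map f []) (f ` S) (map f [])"
      using assms(1) by (rule run_map) (auto simp: f reflect_def[of 0])
    with assms(2) obtain c where "f ` S \<subseteq> {c}"
      by (auto simp: nonconstant_def)
    then show ?thesis
      by blast
  qed
  from annihilator_exists[OF this assms(3)] obtain d0 s where
    d0: "0 < d0" "d0 \<le> 2 ^ (card S - 1)" "s \<in> S" "\<forall>x \<in> S. int r dvd d0 * (x - s)"
    by blast
  define P where "P d \<longleftrightarrow> 0 < d \<and> (\<forall>x \<in> S. int r dvd int d * (x - s))" for d
  have P: "P (nat d0)" "P r"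
    using d0 assms(4) by (auto simp: P_def)
  define d where "d = (LEAST d. P d)"
  have d: "P d" and least: "\<And>k. P k \<Longrightarrow> d \<le> k"
    using P LeastI[of P] Least_le[of P] by (auto simp: d_def)
  have "d \<le> 2 ^ (card S - 1)"
  proof -
    have "int d \<le> d0"
      using least[OF P(1)] d0(1) by linarith
    also have "\<dots> \<le> int (2 ^ (card S - 1))"
      using d0(2) by simp
    finally show ?thesis
      by linarith
  qed
  have "d dvd r"
  proof (rule ccontr)
    assume "\<not> d dvd r"
    then have "0 < r mod d"
      by (simp add: mod_greater_zero_iff_not_dvd)
    moreover have "int r dvd int (r mod d) * (x - s)" if "x \<in> S" for x
    proof -
      have "int (r mod d) * (x - s) = int r * (x - s) - int (r div d) * (int d * (x - s))"
        by (simp add: zmod_int zdiv_int minus_mult_div_eq_mod[symmetric] algebra_simps)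
      then show ?thesis
        using d that by (auto simp: P_def)
    qed
    ultimately have "d \<le> r mod d"
      by (intro least) (simp add: P_def)
    moreover have "r mod d < d"
      using d by (simp add: P_def)
    ultimately show False
      by simp
  qed
  have "d \<noteq> 1"
  proof
    assume "d = 1"
    have "x = s" if "x \<in> S" for x
    proof -
      have "x mod int r = x" "s mod int r = s"
        using run_canonical[OF assms(1)] that d0(3) by auto
      moreover have "int r dvd x - s"
        using d that \<open>d = 1\<close> by (auto simp: P_def)
      ultimately show ?thesis
        by (metis mod_eq_dvd_iff)
    qed
    then have "S \<subseteq> {s}"
      by blast
    then have "card S \<le> card {s}"
      by (intro card_mono) auto
    with assms(3) show False
      by auto
  qed
  then obtain p where p: "prime p" "p dvd d"
    using prime_factor_nat by blast
  have "d > 0"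
    using d by (simp add: P_def)
  define k where "k x = int d * (x - s) div int r" for x
  have k: "int r * k x = int d * (x - s)" if "x \<in> S" for x
    using d that by (auto simp: P_def k_def)
  define f where "f x = k x mod int p" for x
  have "run p D (map f []) (f ` S) (map f [])"
    using assms(1)
  proof (rule run_map)
    fix x y assume xy: "x \<in> S" "y \<in> S" "reflect r y x \<in> S"
    obtain q where q: "reflect r y x = 2 * y - x - int r * q"
      unfolding reflect_def by (metis minus_mult_div_eq_mod)
    have "int r * k (reflect r y x) = int r * (2 * k y - k x - int d * q)"
    proof -
      have "int r * (2 * k y - k x - int d * q) = 2 * (int r * k y) - int r * k x - int d * (int r * q)"
        by (simp add: algebra_simps)
      also have "\<dots> = int d * ((2 * y - x - int r * q) - s)"
        unfolding k[OF xy(1)] k[OF xy(2)] by (simp add: algebra_simps)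
      also have "\<dots> = int r * k (reflect r y x)"
        using k[OF xy(3)] q by simp
      finally show ?thesis ..
    qed
    then have "k (reflect r y x) = 2 * k y - k x - int d * q"
      using assms(4) by simp
    then have "[k (reflect r y x) = 2 * k y - k x] (mod int p)"
      using p(2) by (simp add: cong_iff_dvd_diff)
    then show "f (reflect r y x) = reflect p (f y) (f x)"
      unfolding f_def reflect_mods by (simp add: reflect_def cong_def)
  qed (simp add: f_def)
  moreover have "\<not> f ` S \<subseteq> {c}" for c
  proof
    assume "f ` S \<subseteq> {c}"
    then have "f x = f s" if "x \<in> S" for x
      using that d0(3) by auto
    then have kp: "int p dvd k x" if "x \<in> S" for x
      using that by (auto simp: f_def k_def)
    obtain d' where d': "d = p * d'"
      using p(2) by blast
    have "int r dvd int d' * (x - s)" if x: "x \<in> S" for x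
    proof -
      obtain j where "k x = int p * j"
        using kp[OF x] by blast
      with k[OF x] have "int p * (int d' * (x - s)) = int p * (int r * j)"
        by (simp add: d' algebra_simps)
      with p(1) show ?thesis
        by (simp add: prime_gt_0_nat)
    qed
    moreover have "d' > 0"
      using \<open>d > 0\<close> by (simp add: d')
    ultimately have "d \<le> d'"
      by (intro least) (simp add: P_def)
    with \<open>d' > 0\<close> prime_gt_1_nat[OF p(1)] show False
      by (simp add: d')
  qed
  ultimately have "nonconstant p D"
    by (auto simp: nonconstant_def)
  moreover have "p \<le> d"
    using p(2) \<open>d > 0\<close> by (rule dvd_imp_le)
  ultimately show ?thesis
    using p \<open>d dvd r\<close> \<open>d \<le> 2 ^ (card S - 1)\<close> by (meson dvd_trans le_trans)
qed

section \<open>Colorings of the closed braid\<close>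

lemma step_beside:
  "i + ends_below g \<le> length cs \<Longrightarrow>
     step m i g (cs @ es) fs \<longleftrightarrow> (\<exists>ds. fs = ds @ es \<and> step m i g cs ds)"
proof (induction i arbitrary: cs fs)
  case 0
  then show ?case
    by (cases g) (auto simp: Suc_le_length_iff numeral_eq_Suc)
next
  case (Suc i)
  then obtain c cs' where cs: "cs = c # cs'" "i + ends_below g \<le> length cs'"
    by (cases cs) auto
  show ?case
    unfolding cs(1) append_Cons step.simps list.inject
    using Suc.IH[OF cs(2)] by fastforce
qed

lemma run_beside:
  "tangle (length cs) w b \<Longrightarrow>
     run m w (cs @ es) U fs \<longleftrightarrow> (\<exists>ds V. fs = ds @ es \<and> run m w cs V ds \<and> U = V \<union> set es)"
proof (induction w arbitrary: cs U)
  case (Cons s w)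
  obtain i g where s: "s = (i, g)"
    by (cases s)
  have below: "i + ends_below g \<le> length cs"
    and rest: "tangle (length cs - ends_below g + ends_above g) w b"
    using Cons.prems unfolding s tangle.simps by blast+
  have IH: "run m w (ds @ es) U fs \<longleftrightarrow>
      (\<exists>ds' V. fs = ds' @ es \<and> run m w ds V ds' \<and> U = V \<union> set es)"
    if "step m i g cs ds" for ds U
    using Cons.IH[of ds U] rest step_length[OF that] by presburger
  show ?case
  proof
    assume "run m (s # w) (cs @ es) U fs"
    then obtain ds V where ds: "step m i g cs ds" "run m w (ds @ es) V fs" "U = set (cs @ es) \<union> V"
      unfolding s run.simps step_beside[OF below] by blast
    from ds(2) obtain ds' W where "fs = ds' @ es" "run m w ds W ds'" "V = W \<union> set es"
      unfolding IH[OF ds(1)] by blast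
    moreover from this ds(3) have "U = (set cs \<union> W) \<union> set es"
      by auto
    ultimately show "\<exists>ds V. fs = ds @ es \<and> run m (s # w) cs V ds \<and> U = V \<union> set es"
      unfolding s run.simps using ds(1) by blast
  next
    assume "\<exists>ds V. fs = ds @ es \<and> run m (s # w) cs V ds \<and> U = V \<union> set es"
    then obtain ds ds' W where ds: "fs = ds' @ es" "step m i g cs ds" "run m w ds W ds'"
      "U = (set cs \<union> W) \<union> set es"
      unfolding s run.simps by blast
    have "run m w (ds @ es) (W \<union> set es) fs"
      unfolding IH[OF ds(2)] using ds(1,3) by blast
    moreover have "U = set (cs @ es) \<union> (W \<union> set es)"
      using ds(4) by auto
    ultimately show "run m (s # w) (cs @ es) U fs"
      unfolding s run.simps step_beside[OF below] using ds(2) by blast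
  qed
qed auto

lemma braid_closure_3:
  "braid_closure 3 w = [(0, Cup), (Suc 0, Cup), (Suc (Suc 0), Cup)] @ w @ [(Suc (Suc 0), Cap), (Suc 0, Cap), (0, Cap)]"
  by (simp add: braid_closure_def upt_rec numeral_eq_Suc)

lemma cups_run:
  "run m [(0, Cup), (Suc 0, Cup), (Suc (Suc 0), Cup)] [] V cs \<longleftrightarrow>
     (\<exists>a b c. {a, b, c} \<subseteq> {x. x mod int m = x} \<and> cs = [a, b, c] @ [c, b, a] \<and> V = {a, b, c})"
  by auto

lemma caps_run:
  "run m [(Suc (Suc 0), Cap), (Suc 0, Cap), (0, Cap)] cs V [] \<longleftrightarrow>
     (\<exists>a b c. cs = [a, b, c] @ [c, b, a] \<and> V = {a, b, c})"
  by auto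

text \<open>
The nested caps force the level on top of the braid to agree with the level below it, while the
return strands add no new colors.
\<close>

lemma run_braid_closure:
  assumes "tangle 3 w 3"
  shows "run m (braid_closure 3 w) [] U [] \<longleftrightarrow>
    (\<exists>a b c. {a, b, c} \<subseteq> {x. x mod int m = x} \<and> run m w [a, b, c] U [a, b, c])"
    (is "?L \<longleftrightarrow> ?R")
proof -
  have braid: "run m w ([a, b, c] @ [c, b, a]) V cs \<longleftrightarrow>
      (\<exists>ds W. cs = ds @ [c, b, a] \<and> run m w [a, b, c] W ds \<and> V = W \<union> {c, b, a})" for a b c V cs
    using assms by (subst run_beside[of _ _ 3]) (auto simp: numeral_eq_Suc)
  have ends: "run m w [a, b, c] W ds \<Longrightarrow> {a, b, c} \<subseteq> W" for a b c W ds
    using run_ends[of m w "[a, b, c]" W ds] by simp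
  show ?thesis
  proof
    assume ?L
    then obtain cs ds V1 V2 V3 where
      1: "run m [(0, Cup), (Suc 0, Cup), (Suc (Suc 0), Cup)] [] V1 cs" "run m w cs V2 ds"
        "run m [(Suc (Suc 0), Cap), (Suc 0, Cap), (0, Cap)] ds V3 []" and U: "U = V1 \<union> (V2 \<union> V3)"
      unfolding braid_closure_3 run_append by blast
    from 1(1) obtain a b c where
      abc: "{a, b, c} \<subseteq> {x. x mod int m = x}" "cs = [a, b, c] @ [c, b, a]" "V1 = {a, b, c}"
      unfolding cups_run by blast
    from 1(2) obtain es W where W: "ds = es @ [c, b, a]" "run m w [a, b, c] W es" "V2 = W \<union> {c, b, a}"
      unfolding abc(2) braid by blast
    from 1(3) W(1) have "es = [a, b, c]" "V3 = {a, b, c}"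
      unfolding caps_run by auto
    moreover from this U abc(3) W(3) ends[OF W(2)] have "U = W"
      by auto
    ultimately show ?R
      using abc(1) W(2) by blast
  next
    assume ?R
    then obtain a b c where abc: "{a, b, c} \<subseteq> {x. x mod int m = x}" "run m w [a, b, c] U [a, b, c]"
      by blast
    have 1: "run m [(0, Cup), (Suc 0, Cup), (Suc (Suc 0), Cup)] [] {a, b, c} ([a, b, c] @ [c, b, a])"
      unfolding cups_run using abc(1) by blast
    have 2: "run m w ([a, b, c] @ [c, b, a]) (U \<union> {c, b, a}) ([a, b, c] @ [c, b, a])"
      unfolding braid using abc(2) by blast
    have 3: "run m [(Suc (Suc 0), Cap), (Suc 0, Cap), (0, Cap)] ([a, b, c] @ [c, b, a]) {a, b, c} []"
      unfolding caps_run by blast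
    have "U = {a, b, c} \<union> ((U \<union> {c, b, a}) \<union> {a, b, c})"
      using ends[OF abc(2)] by auto
    with 1 2 3 show ?L
      unfolding braid_closure_3 run_append by (intro exI conjI) (assumption | rule refl)+
  qed
qed

text \<open>
The colors of the arcs in the order of their birth, as integers. Each period of the braid gives birth
to two arcs. The colors \<open>a\<close>, \<open>b\<close>, \<open>c\<close> belong to the strands \<open>0\<close>, \<open>1\<close>, \<open>2\<close> of the initial level; the arc
at strand \<open>2\<close>, which is the next to end at an under-crossing, comes first.
\<close>

fun arc_color :: "int \<Rightarrow> int \<Rightarrow> int \<Rightarrow> nat \<Rightarrow> int" where
  "arc_color a b c 0 = c"
| "arc_color a b c (Suc 0) = a"
| "arc_color a b c (Suc (Suc 0)) = b"
| "arc_color a b c (Suc (Suc (Suc k))) = 2 * arc_color a b c (Suc (Suc k)) - arc_color a b c k"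

text \<open>
The Lucas numbers with even indices. They are the traces of the powers of the matrix by which one
period of the braid acts on differences of colors.
\<close>

fun even_lucas :: "nat \<Rightarrow> int" where
  "even_lucas 0 = 2"
| "even_lucas (Suc 0) = 3"
| "even_lucas (Suc (Suc n)) = 3 * even_lucas (Suc n) - even_lucas n"

lemma tangle_THK3_braid: "tangle 3 (THK3_braid n) 3"
  by (induction n) (simp_all add: THK3_braid_def sigma_def sigma_inv_def numeral_3_eq_3)

text \<open>
One period of the braid advances the sequence by two arcs, one for each of its crossings.
\<close>

lemma run_THK3_braid:
  fixes a b c :: int and m :: nat
  defines "s \<equiv> \<lambda>k. arc_color a b c k mod int m"
  shows "run m (THK3_braid n) [s (Suc k), s (Suc (Suc k)), s k] U cs \<Longrightarrow>
    cs = [s (Suc (k + 2 * n)), s (Suc (Suc (k + 2 * n))), s (k + 2 * n)] \<and>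
    U \<subseteq> range s"
proof (induction n arbitrary: k U)
  case 0
  then show ?case
    by (auto simp: THK3_braid_def)
next
  case (Suc n)
  have rec: "reflect m (s (Suc (Suc k))) (s k) = s (Suc (Suc (Suc k)))" for k
    by (simp add: s_def reflect_mods) (simp add: reflect_def)
  have "THK3_braid (Suc n) = (Suc 0, Over) # (0, Under) # THK3_braid n"
    by (simp add: THK3_braid_def sigma_def sigma_inv_def)
  with Suc.prems obtain V where
    "run m (THK3_braid n) [s (Suc (Suc (Suc k))), s (Suc (Suc (Suc (Suc k)))), s (Suc (Suc k))] V cs"
    "U \<subseteq> V \<union> range s"
    by (auto simp: run_base rec simp del: run.simps(2))
  from Suc.IH[OF this(1)] this(2) show ?case
    by auto
qed

text \<open>
If \<open>M\<close> is the matrix by which \<open>j\<close> periods act on consecutive differences, then \<open>det M = 1\<close>, so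
that \<open>M + M\<^sup>-\<^sup>1\<close> is the trace of \<open>M\<close> times the identity. The proof is by induction on \<open>j\<close>, using
\<open>t (k + 4) = 3 * t (k + 2) - t k\<close> on both sides.
\<close>

lemma arc_color_difference_lucas:
  fixes a b c :: int
  defines "t \<equiv> \<lambda>k. arc_color a b c (Suc k) - arc_color a b c k"
  shows "t (k + 4 * j) + t k = even_lucas j * t (k + 2 * j)"
proof (induction j arbitrary: k rule: even_lucas.induct)
  case 1
  show ?case
    by simp
next
  case 2
  show ?case
    by (simp add: t_def eval_nat_numeral)
next
  case (3 n)
  have fib: "t (Suc (Suc i)) = t (Suc i) + t i" for i
    by (simp add: t_def)
  have centre: "k + 2 * Suc (Suc n) = (k + 2) + 2 * Suc n" "(k + 2) + 2 * Suc n = (k + 4) + 2 * n"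
    by simp_all
  have "even_lucas (Suc (Suc n)) * t (k + 2 * Suc (Suc n)) =
      3 * (even_lucas (Suc n) * t ((k + 2) + 2 * Suc n)) - even_lucas n * t ((k + 4) + 2 * n)"
    unfolding centre even_lucas.simps by (simp only: left_diff_distrib mult.assoc)
  also have "\<dots> = 3 * (t ((k + 2) + 4 * Suc n) + t (k + 2)) - (t ((k + 4) + 4 * n) + t (k + 4))"
    unfolding 3 ..
  also have "\<dots> = t (k + 4 * Suc (Suc n)) + t k"
    using fib[of k] fib[of "k + 1"] fib[of "k + 2"] fib[of "k + 4 * n + 4"] fib[of "k + 4 * n + 5"]
      fib[of "k + 4 * n + 6"] by (simp add: eval_nat_numeral)
  finally show ?case ..
qed

text \<open>
A nonconstant coloring has a difference \<open>t k\<close> that does not vanish modulo \<open>m\<close>. By periodicity the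
preceding lemma turns into \<open>2 * t k = even_lucas n * t k\<close>.
\<close>

lemma nonconstant_closure_imp:
  assumes "nonconstant m (braid_closure 3 (THK3_braid n))"
  shows "\<exists>d. \<not> int m dvd d \<and> int m dvd (even_lucas n - 2) * d"
proof -
  from assms obtain U a b c where can: "a mod int m = a" "b mod int m = b" "c mod int m = c"
    and U: "run m (THK3_braid n) [a, b, c] U [a, b, c]" "\<forall>c. \<not> U \<subseteq> {c}"
    unfolding nonconstant_def run_braid_closure[OF tangle_THK3_braid] by auto
  define s where "s = (\<lambda>k. arc_color a b c k)"
  define t where "t = (\<lambda>k. s (Suc k) - s k)"
  have start: "s (Suc 0) mod int m = a" "s (Suc (Suc 0)) mod int m = b" "s 0 mod int m = c"
    by (simp_all add: s_def can)
  have "[a, b, c] = [s (Suc (0 + 2 * n)) mod int m, s (Suc (Suc (0 + 2 * n))) mod int m, s (0 + 2 * n) mod int m]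
      \<and> U \<subseteq> range (\<lambda>k. s k mod int m)"
    unfolding s_def by (rule run_THK3_braid) (simp add: can U(1))
  then have per: "s (Suc (2 * n)) mod int m = a" "s (Suc (Suc (2 * n))) mod int m = b"
      "s (2 * n) mod int m = c" and range: "U \<subseteq> range (\<lambda>k. s k mod int m)"
    by simp_all
  have rec: "s (Suc (Suc (Suc k))) = 2 * s (Suc (Suc k)) - s k" for k
    by (simp add: s_def)
  have period: "[s (k + 2 * n) = s k] (mod int m)" for k
  proof (induction k rule: less_induct)
    case (less k)
    consider "k = 0" | "k = Suc 0" | "k = Suc (Suc 0)" | i where "k = Suc (Suc (Suc i))"
      by (metis not0_implies_Suc)
    then show ?case
    proof cases
      case 4
      have "[2 * s (Suc (Suc i) + 2 * n) - s (i + 2 * n) = 2 * s (Suc (Suc i)) - s i] (mod int m)"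
        using less.IH[of "Suc (Suc i)"] less.IH[of i] by (intro cong_diff cong_mult) (simp_all add: 4)
      then show ?thesis
        by (simp add: 4 rec)
    qed (simp_all add: cong_def per start)
  qed
  have "[t (k + 2 * n) = t k] (mod int m)" for k
    using period[of "Suc k"] period[of k] by (simp add: t_def cong_diff)
  note tt = this
  have tt2: "[t (k + 4 * n) = t k] (mod int m)" for k
    using cong_trans[OF tt[of "k + 2 * n"] tt[of k]] by (simp add: add.assoc)
  have dvd: "int m dvd (even_lucas n - 2) * t k" for k
  proof -
    have "even_lucas n * t (k + 2 * n) = t (k + 4 * n) + t k"
      unfolding t_def s_def by (rule arc_color_difference_lucas[symmetric])
    moreover have "[even_lucas n * t (k + 2 * n) = even_lucas n * t k] (mod int m)"
      "[t (k + 4 * n) + t k = t k + t k] (mod int m)"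
      by (intro cong_mult cong_add cong_refl tt tt2)+
    ultimately have "[even_lucas n * t k = t k + t k] (mod int m)"
      by (metis cong_sym cong_trans)
    then show ?thesis
      by (simp add: cong_iff_dvd_diff algebra_simps)
  qed
  have "\<exists>k. \<not> int m dvd t k"
  proof (rule ccontr)
    assume "\<nexists>k. \<not> int m dvd t k"
    then have "s (Suc k) mod int m = s k mod int m" for k
      by (simp add: t_def mod_eq_dvd_iff)
    then have "s k mod int m = s 0 mod int m" for k
      by (induction k) simp_all
    with range have "U \<subseteq> {s 0 mod int m}"
      by auto
    with U(2) show False
      by blast
  qed
  with dvd show ?thesis
    by blast
qed

lemma even_lucas_gt_2: "n > 0 \<Longrightarrow> even_lucas n > 2"
proof -
  have *: "even_lucas n \<ge> 2 \<and> even_lucas n < even_lucas (Suc n)" for n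
    by (induction n) auto
  show "n > 0 \<Longrightarrow> even_lucas n > 2"
    using *[of "n - 1"] by simp
qed

lemma nonconstant_closure_0: "n > 0 \<Longrightarrow> \<not> nonconstant 0 (braid_closure 3 (THK3_braid n))"
  using nonconstant_closure_imp[of 0 n] even_lucas_gt_2[of n] by auto

lemma nonconstant_closure_prime:
  "prime p \<Longrightarrow> nonconstant p (braid_closure 3 (THK3_braid n)) \<Longrightarrow> even_lucas n mod int p = 2 mod int p"
  using nonconstant_closure_imp[of p n]
  by (auto simp: mod_eq_dvd_iff prime_dvd_mult_iff)

text \<open>
It suffices to check one period of residues \<open>xs\<close> against the recursion.
\<close>

lemma even_lucas_mod:
  assumes "2 \<le> length xs" and "xs ! 0 = 2 mod q" and "xs ! 1 = 3 mod q"
    and "\<forall>i \<in> set [0..<length xs]. xs ! (Suc (Suc i) mod length xs) = (3 * xs ! (Suc i mod length xs) - xs ! i) mod q"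
  shows "even_lucas n mod q = xs ! (n mod length xs)"
proof (induction n rule: even_lucas.induct)
  case (3 n)
  have "even_lucas (Suc (Suc n)) mod q = (3 * (even_lucas (Suc n) mod q) - even_lucas n mod q) mod q"
  proof -
    have "(3 * (even_lucas (Suc n) mod q) - even_lucas n mod q) mod q
        = ((3 * (even_lucas (Suc n) mod q)) mod q - even_lucas n mod q mod q) mod q"
      by (rule mod_diff_eq[symmetric])
    also have "\<dots> = even_lucas (Suc (Suc n)) mod q"
      unfolding mod_mult_right_eq mod_mod_trivial even_lucas.simps by (rule mod_diff_eq)
    finally show ?thesis ..
  qed
  also have "\<dots> = (3 * xs ! (Suc (n mod length xs) mod length xs) - xs ! (n mod length xs)) mod q"
    unfolding 3 mod_Suc_eq ..
  also have "\<dots> = xs ! (Suc (Suc (n mod length xs)) mod length xs)"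
  proof -
    have "n mod length xs \<in> set [0..<length xs]"
      using mod_less_divisor[of "length xs" n] order.strict_trans2[OF zero_less_numeral assms(1)] by simp
    with assms(4) show ?thesis
      by metis
  qed
  also have "\<dots> = xs ! (Suc (Suc n) mod length xs)"
    using mod_Suc_Suc_eq[of n "length xs"] by simp
  finally show ?case .
qed (use assms(1-3) in auto)

lemma even_lucas_mod_eq_2_imp:
  assumes "2 \<le> length xs" and "xs ! 0 = 2 mod q" and "xs ! 1 = 3 mod q"
    and "\<forall>i \<in> set [0..<length xs]. xs ! (Suc (Suc i) mod length xs) = (3 * xs ! (Suc i mod length xs) - xs ! i) mod q"
    and "\<forall>i \<in> set [0..<length xs]. xs ! i = 2 mod q \<longrightarrow> i = 0"
    and "even_lucas n mod q = 2 mod q"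
  shows "length xs dvd n"
proof -
  have "n mod length xs \<in> set [0..<length xs]"
    using mod_less_divisor[of "length xs" n] order.strict_trans2[OF zero_less_numeral assms(1)] by simp
  with assms(5,6) even_lucas_mod[OF assms(1-4), of n] show ?thesis
    by (metis mod_0_imp_dvd)
qed

lemma even_lucas_mod_primes:
  "even_lucas n mod 2 = 2 mod 2 \<Longrightarrow> 3 dvd n"
  "even_lucas n mod 3 = 2 mod 3 \<Longrightarrow> 4 dvd n"
  "even_lucas n mod 5 = 2 mod 5 \<Longrightarrow> 2 dvd n"
  "even_lucas n mod 7 = 2 mod 7 \<Longrightarrow> 8 dvd n"
proof -
  have "length ([0, 1, 1] :: int list) dvd n" if "even_lucas n mod 2 = 2 mod 2"
    by (rule even_lucas_mod_eq_2_imp[OF _ _ _ _ _ that]) code_simp+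
  then show "even_lucas n mod 2 = 2 mod 2 \<Longrightarrow> 3 dvd n"
    by (simp add: eval_nat_numeral)
  have "length ([2, 0, 1, 0] :: int list) dvd n" if "even_lucas n mod 3 = 2 mod 3"
    by (rule even_lucas_mod_eq_2_imp[OF _ _ _ _ _ that]) code_simp+
  then show "even_lucas n mod 3 = 2 mod 3 \<Longrightarrow> 4 dvd n"
    by (simp add: eval_nat_numeral)
  have "length ([2, 3] :: int list) dvd n" if "even_lucas n mod 5 = 2 mod 5"
    by (rule even_lucas_mod_eq_2_imp[OF _ _ _ _ _ that]) code_simp+
  then show "even_lucas n mod 5 = 2 mod 5 \<Longrightarrow> 2 dvd n"
    by (simp add: eval_nat_numeral)
  have "length ([2, 3, 0, 4, 5, 4, 0, 3] :: int list) dvd n" if "even_lucas n mod 7 = 2 mod 7"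
    by (rule even_lucas_mod_eq_2_imp[OF _ _ _ _ _ that]) code_simp+
  then show "even_lucas n mod 7 = 2 mod 7 \<Longrightarrow> 8 dvd n"
    by (simp add: eval_nat_numeral)
qed

section \<open>Equivalence of tangles, and colored blocks\<close>

text \<open>
Since the number of strands at the two ends stays \<open>a\<close>, equivalent words may replace each other inside
larger words, in particular inside closed braids.
\<close>

definition tangle_step :: "nat \<Rightarrow> slice list \<Rightarrow> slice list \<Rightarrow> bool" where
  "tangle_step a w w' \<longleftrightarrow> tangle a w a \<and> tangle a w' a \<and>
     (\<exists>u v x x'. move x x' \<and> w = u @ x @ v \<and> w' = u @ x' @ v)"

abbreviation tangle_equiv :: "nat \<Rightarrow> slice list \<Rightarrow> slice list \<Rightarrow> bool" where
  "tangle_equiv a \<equiv> equivclp (tangle_step a)"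

lemma equivclp_map:
  assumes "equivclp R x y" and "\<And>x y. R x y \<Longrightarrow> S (f x) (f y)"
  shows "equivclp S (f x) (f y)"
  using assms(1)
proof (induction rule: equivclp_induct)
  case (step y z)
  then have "equivclp S (f y) (f z)"
    using assms(2) by (meson converse_r_into_equivclp r_into_equivclp)
  with step.IH show ?case
    by (rule equivclp_trans)
qed simp

lemma tangle_equiv_append:
  assumes "tangle_equiv a w w'" and "tangle a u a" and "tangle a v a"
  shows "tangle_equiv a (u @ w @ v) (u @ w' @ v)"
  using assms(1)
proof (rule equivclp_map)
  fix x y assume "tangle_step a x y"
  then obtain u' v' z z' where "tangle a x a" "tangle a y a" "move z z'" "x = u' @ z @ v'" "y = u' @ z' @ v'"
    unfolding tangle_step_def by blast
  moreover from this assms(2,3) have "tangle a (u @ x @ v) a" "tangle a (u @ y @ v) a"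
    unfolding tangle_append by blast+
  ultimately show "tangle_step a (u @ x @ v) (u @ y @ v)"
    unfolding tangle_step_def by (metis append.assoc)
qed

lemma tangle_replicate: "tangle a w a \<Longrightarrow> tangle a (concat (replicate j w)) a"
  by (induction j) (auto simp: tangle_append)

lemma tangle_equiv_replicate:
  assumes "tangle_equiv a w w'" and "tangle a w a" and "tangle a w' a"
  shows "tangle_equiv a (concat (replicate j w)) (concat (replicate j w'))"
proof (induction j)
  case (Suc j)
  have "tangle_equiv a ([] @ w @ concat (replicate j w)) ([] @ w' @ concat (replicate j w))"
    using assms by (intro tangle_equiv_append tangle_replicate) auto
  moreover have "tangle_equiv a (w' @ concat (replicate j w) @ []) (w' @ concat (replicate j w') @ [])"
    using assms(3) Suc by (intro tangle_equiv_append) auto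
  ultimately show ?case
    using equivclp_trans by fastforce
qed simp

lemma tangle_beside: "tangle a w b \<Longrightarrow> tangle (a + e) w (b + e)"
proof (induction w arbitrary: a)
  case (Cons s w)
  obtain i g where s: "s = (i, g)"
    by (cases s)
  from Cons.prems have "i + ends_below g \<le> a"
    "tangle (a - ends_below g + ends_above g) w b"
    unfolding s tangle.simps by blast+
  moreover from this have "a + e - ends_below g + ends_above g = (a - ends_below g + ends_above g) + e"
    "i + ends_below g \<le> a + e"
    by linarith+
  ultimately show ?case
    unfolding s tangle.simps using Cons.IH by metis
qed simp

lemma diagram_braid_closure:
  assumes "tangle 3 w 3"
  shows "diagram (braid_closure 3 w)"
proof -
  have "tangle 6 w 6"
    using tangle_beside[OF assms, of 3] by simp
  moreover have "tangle 0 [(0, Cup), (Suc 0, Cup), (Suc (Suc 0), Cup)] 6"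
    "tangle 6 [(Suc (Suc 0), Cap), (Suc 0, Cap), (0, Cap)] 0"
    by (simp_all add: numeral_eq_Suc)
  ultimately show ?thesis
    unfolding diagram_def braid_closure_3 tangle_append by blast
qed

lemma closure_equiv:
  assumes "tangle_equiv 3 w w'"
  shows "equivclp diagram_step (braid_closure 3 w) (braid_closure 3 w')"
  using assms
proof (rule equivclp_map)
  fix x y assume "tangle_step 3 x y"
  then obtain u v z z' where 1: "tangle 3 x 3" "tangle 3 y 3" "move z z'" "x = u @ z @ v" "y = u @ z' @ v"
    unfolding tangle_step_def by blast
  have "braid_closure 3 x = ([(0, Cup), (Suc 0, Cup), (Suc (Suc 0), Cup)] @ u) @ z @ (v @ [(Suc (Suc 0), Cap), (Suc 0, Cap), (0, Cap)])"
    "braid_closure 3 y = ([(0, Cup), (Suc 0, Cup), (Suc (Suc 0), Cup)] @ u) @ z' @ (v @ [(Suc (Suc 0), Cap), (Suc 0, Cap), (0, Cap)])"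
    unfolding braid_closure_3 1(4,5) by simp_all
  with 1(3) diagram_braid_closure[OF 1(1)] diagram_braid_closure[OF 1(2)]
  show "diagram_step (braid_closure 3 x) (braid_closure 3 y)"
    unfolding diagram_step_def by blast
qed

text \<open>
An executable form of the moves, used to check explicit chains of moves.
\<close>

fun is_move :: "slice list \<Rightarrow> slice list \<Rightarrow> bool" where
  "is_move [(i, g), (j, h)] y \<longleftrightarrow>
       i + ends_above g \<le> j \<and> y = [(j - ends_above g + ends_below g, h), (i, g)]
     \<or> g = Cup \<and> h = Cap \<and> (j = Suc i \<or> i = Suc j) \<and> y = []
     \<or> g = Cup \<and> h = Under \<and> (j = Suc i \<and> y = [(j, Cup), (i, Over)] \<or> j = i \<and> y = [(i, Cup)])
     \<or> g = Cup \<and> h = Over \<and> (j = Suc i \<and> y = [(j, Cup), (i, Under)] \<or> j = i \<and> y = [(i, Cup)])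
     \<or> g = Over \<and> h = Cap \<and> (i = Suc j \<and> y = [(j, Under), (i, Cap)] \<or> j = i \<and> y = [(i, Cap)])
     \<or> g = Under \<and> h = Cap \<and> (i = Suc j \<and> y = [(j, Over), (i, Cap)] \<or> j = i \<and> y = [(i, Cap)])
     \<or> (g = Over \<and> h = Under \<or> g = Under \<and> h = Over) \<and> j = i \<and> y = []"
| "is_move [(i, g), (j, h), (k, l)] y \<longleftrightarrow>
     g = Over \<and> h = Over \<and> l = Over \<and> j = Suc i \<and> k = i \<and> y = [(j, Over), (i, Over), (j, Over)]"
| "is_move _ _ \<longleftrightarrow> False"

lemma is_move_imp_move: "is_move x y \<Longrightarrow> move x y"
proof (induction x y rule: is_move.induct)
  case (1 i g j h y)
  show ?case
  proof (cases "i + ends_above g \<le> j \<and> y = [(j - ends_above g + ends_below g, h), (i, g)]")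
    case True
    then obtain k where "j = i + ends_above g + k"
      using le_Suc_ex by blast
    with True move.exchange[of i g k h] show ?thesis
      by (simp add: add.commute add.left_commute)
  next
    case False
    with 1 show ?thesis
      by (auto intro: move.intros)
  qed
qed (auto intro: move.intros)

text \<open>
A chain of moves given by triples: the position at which a factor of the word starts, the length of the
factor, and the word that replaces it.
\<close>

fun derivation :: "nat \<Rightarrow> slice list \<Rightarrow> (nat \<times> nat \<times> slice list) list \<Rightarrow> slice list \<Rightarrow> bool" where
  "derivation a w [] w' \<longleftrightarrow> w = w'"
| "derivation a w ((p, l, y) # ds) w' \<longleftrightarrow>
     (let x = take l (drop p w); v = take p w @ y @ drop l (drop p w)
      in (is_move x y \<or> is_move y x) \<and> tangle a v a \<and> derivation a v ds w')"

lemma derivation_imp_equiv: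
  "tangle a w a \<Longrightarrow> derivation a w ds w' \<Longrightarrow> tangle_equiv a w w'"
proof (induction ds arbitrary: w)
  case (Cons d ds)
  obtain p l y where d: "d = (p, l, y)"
    by (cases d)
  define x v where "x = take l (drop p w)" and "v = take p w @ y @ drop l (drop p w)"
  with Cons.prems d have 1: "move x y \<or> move y x" "tangle a v a" "derivation a v ds w'"
    by (auto simp: Let_def dest: is_move_imp_move)
  have "w = take p w @ x @ drop l (drop p w)"
    by (simp only: x_def append_take_drop_id)
  with 1 Cons.prems(1) v_def have "tangle_step a w v \<or> tangle_step a v w"
    unfolding tangle_step_def by metis
  then have "tangle_equiv a w v"
    by (meson converse_r_into_equivclp r_into_equivclp)
  from equivclp_trans[OF this Cons.IH[OF 1(2,3)]] show ?case .
qed simp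

text \<open>
An executable form of \<open>run\<close>. The colors of the minima, which the level below leaves open, are taken
from the list \<open>ys\<close>; all colors have to lie in the palette \<open>L\<close>.
\<close>

fun follow :: "nat \<Rightarrow> int list \<Rightarrow> int list \<Rightarrow> slice list \<Rightarrow> int list \<Rightarrow> int list \<Rightarrow> bool" where
  "follow m L ys [] cs cs' \<longleftrightarrow> cs' = cs \<and> set cs \<subseteq> set L"
| "follow m L ys ((i, g) # w) cs cs' \<longleftrightarrow> i \<le> length cs \<and> set cs \<subseteq> set L \<and>
     (case g of
        Cup \<Rightarrow> (case ys of y # ys' \<Rightarrow>
          y mod int m = y \<and> follow m L ys' w (take i cs @ y # y # drop i cs) cs' | [] \<Rightarrow> False)
      | Cap \<Rightarrow> (case drop i cs of x # y # vs \<Rightarrow> x = y \<and> follow m L ys w (take i cs @ vs) cs' | _ \<Rightarrow> False)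
      | Over \<Rightarrow> (case drop i cs of y # x # vs \<Rightarrow> follow m L ys w (take i cs @ reflect m y x # y # vs) cs' | _ \<Rightarrow> False)
      | Under \<Rightarrow> (case drop i cs of x # y # vs \<Rightarrow> follow m L ys w (take i cs @ y # reflect m y x # vs) cs' | _ \<Rightarrow> False))"

lemma follow_imp_run:
  "follow m L ys w cs cs' \<Longrightarrow> \<exists>U. run m w cs U cs' \<and> U \<subseteq> set L"
proof (induction w arbitrary: cs ys)
  case (Cons s w)
  obtain i g where s: "s = (i, g)"
    by (cases s)
  have i: "i \<le> length cs" and cs: "set cs \<subseteq> set L"
    using Cons.prems by (simp_all add: s)
  obtain vs ys' where 1: "step m 0 g (drop i cs) vs" "follow m L ys' w (take i cs @ vs) cs'"
    using Cons.prems by (cases g) (auto simp: s split: list.splits)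
  from 1(1) i have "step m i g cs (take i cs @ vs)"
    using step_append[of "take i cs" i m g "drop i cs" vs] by simp
  moreover from Cons.IH[OF 1(2)] obtain V where "run m w (take i cs @ vs) V cs'" "V \<subseteq> set L"
    by blast
  ultimately show ?case
    unfolding s using cs by (intro exI[of _ "set cs \<union> V"]) auto
qed auto

text \<open>
Here \<open>W\<close> may be any tangle equivalent to \<open>q\<close> periods of the braid. Its coloring is repeated \<open>n div q\<close>
times and closed up, and then multiplied by \<open>r div p\<close>.
\<close>

lemma THK3_colored_by_block:
  assumes "p > 0" "p dvd r" "r > 0" and W: "tangle_equiv 3 (THK3_braid q) W" "tangle 3 W 3"
    and L: "follow p L ys W [a, b, c] [a, b, c]" "{a, b, c} \<subseteq> {0..<int p}" "\<not> (a = b \<and> b = c)"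
    and "q dvd n" "n > 0"
  shows "\<exists>D \<in> THK3 n. \<exists>C. nontrivial_coloring r D C \<and> card (colors_used C) \<le> card (set L)"
proof -
  obtain j where n: "n = j * q"
    using \<open>q dvd n\<close> by (metis dvd_def mult.commute)
  have "THK3_braid n = concat (replicate j (THK3_braid q))"
    unfolding n by (induction j) (simp_all add: THK3_braid_def replicate_add)
  then have equiv: "equivclp diagram_step (braid_closure 3 (THK3_braid n)) (braid_closure 3 (concat (replicate j W)))"
    using W tangle_THK3_braid[of q] by (simp add: closure_equiv tangle_equiv_replicate)
  from follow_imp_run[OF L(1)] obtain U where U: "run p W [a, b, c] U [a, b, c]" "U \<subseteq> set L"
    by blast
  have "run p (concat (replicate j W)) [a, b, c] U [a, b, c]"
    if "j > 0" for j
    using that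
  proof (induction j)
    case (Suc j)
    show ?case
    proof (cases "j = 0")
      case False
      with Suc have "run p (concat (replicate j W)) [a, b, c] U [a, b, c]"
        by simp
      with U(1) have "run p (W @ concat (replicate j W)) [a, b, c] (U \<union> U) [a, b, c]"
        unfolding run_append by blast
      then show ?thesis
        by simp
    qed (use U(1) in simp)
  qed simp
  moreover have "j > 0"
    using \<open>n > 0\<close> by (simp add: n)
  ultimately have run1: "run p (concat (replicate j W)) [a, b, c] U [a, b, c]"
    by blast
  have can: "{a, b, c} \<subseteq> {x. x mod int p = x}"
    using L(2) residue_iff_canonical[OF \<open>p > 0\<close>] by blast
  have tangleW: "tangle 3 (concat (replicate j W)) 3"
    by (rule tangle_replicate[OF W(2)])
  have run2: "run p (braid_closure 3 (concat (replicate j W))) [] U []"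
    unfolding run_braid_closure[OF tangleW] using can run1 by blast
  obtain k where r: "r = p * k"
    using \<open>p dvd r\<close> by blast
  have "int k > 0"
    using \<open>r > 0\<close> by (simp add: r)
  have "run r (braid_closure 3 (concat (replicate j W))) (map (\<lambda>x. x * int k) [])
      ((\<lambda>x. x * int k) ` U) (map (\<lambda>x. x * int k) [])"
    using run2
  proof (rule run_map)
    fix x assume "x \<in> U"
    then have "x mod int p = x"
      using run_canonical[OF run2] by simp
    then show "x * int k mod int r = x * int k"
      by (simp add: r flip: mult_mod_left)
  next
    fix x y
    show "reflect p y x * int k = reflect r (y * int k) (x * int k)"
      unfolding reflect_def r of_nat_mult mult_mod_left by (simp add: left_diff_distrib mult.assoc)
  qed
  then obtain C where C: "coloring r (braid_closure 3 (concat (replicate j W))) C"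
    "colors_used C = (\<lambda>x. x * int k) ` U"
    using run_imp_coloring[OF _ \<open>r > 0\<close>] by (metis list.map(1))
  have "{a, b, c} \<subseteq> U"
    using run_ends[OF U(1)] by simp
  have "finite U"
    using U(2) finite_subset by blast
  have "card U \<ge> 2"
  proof -
    have "card {a, b, c} \<ge> 2"
      using L(3) by (auto simp: card_insert_if)
    then show ?thesis
      using card_mono[OF \<open>finite U\<close> \<open>{a, b, c} \<subseteq> U\<close>] by simp
  qed
  moreover have "card (colors_used C) = card U"
    unfolding C(2) by (rule card_image) (use \<open>int k > 0\<close> in \<open>auto simp: inj_on_def\<close>)
  ultimately have "nontrivial_coloring r (braid_closure 3 (concat (replicate j W))) C"
    "card (colors_used C) \<le> card (set L)"
    using C(1) card_mono[OF _ U(2)] by (auto simp: nontrivial_coloring_def)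
  moreover have "braid_closure 3 (concat (replicate j W)) \<in> THK3 n"
    using equiv diagram_braid_closure[OF tangleW] by (simp add: THK3_def link_of_def)
  ultimately show ?thesis
    by blast
qed

section \<open>A block with four colors modulo 7\<close>

text \<open>
Starting from the colors \<open>2, 2, 1\<close> of the three strands modulo \<open>7\<close>, the arcs of eight periods of the braid
are, in the order of their birth, \<open>1, 2, 2, 3, 4, 6, 2, 0, 1, 0, 0, 6, 5, 3, 0, 2\<close>. Only \<open>0, 1, 2, 4\<close>
are to be kept. This set is closed under doubling, and a crossing between different colors of it has an
over-arc \<open>y \<noteq> 0\<close> and the under-arcs \<open>0\<close> and \<open>2 * y\<close>. The unwanted colors \<open>3\<close> and \<open>6\<close> of the first
half occur within three periods, the colors \<open>6, 5, 3\<close> of the second half within the remaining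
five, and the level between these two parts has the colors \<open>0, 1, 2\<close>. So the parts can be
replaced independently.
\<close>

definition block3 :: "slice list" where
  "block3 = [
    (0, Under), (1, Under), (2, Cup), (3, Over), (1, Under), (2, Under), (1, Over), (0, Over),
    (3, Over), (2, Over), (1, Under), (2, Under), (0, Over), (1, Cap)]"

definition block5 :: "slice list" where
  "block5 = [
    (0, Cup), (2, Under), (3, Cup), (5, Under), (1, Under), (5, Under), (2, Over), (1, Over),
    (4, Under), (3, Over), (2, Over), (3, Over), (4, Over), (0, Under), (3, Under), (4, Over),
    (3, Over), (5, Under), (2, Under), (1, Cap), (2, Cap), (1, Over), (0, Under)]"

text \<open>
The first steps stay among braid words: insertions of inverse crossings make the braid relation
applicable. Then a minimum and a maximum are inserted and pulled apart.
\<close>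

lemma block3_equiv: "tangle_equiv 3 (THK3_braid 3) block3"
  by (rule derivation_imp_equiv[where ds = "[(4, 0, [(1, Under), (1, Over)]), (2, 0, [(0, Under), (0, Over)]),
    (3, 0, [(1, Under), (1, Over)]), (4, 3, [(0, Over), (1, Over), (0, Over)]), (6, 2, []),
    (5, 2, []), (2, 0, [(1, Under), (1, Over)]), (0, 0, [(0, Under), (0, Over)]),
    (1, 0, [(1, Under), (1, Over)]), (2, 3, [(0, Over), (1, Over), (0, Over)]), (4, 2, []),
    (3, 2, []), (2, 0, [(1, Under), (1, Over)]), (3, 3, [(0, Over), (1, Over), (0, Over)]),
    (5, 2, []), (4, 2, []), (6, 0, [(3, Cup), (2, Cap)]), (5, 2, [(3, Cup), (1, Over)]),
    (4, 2, [(3, Cup), (0, Over)]), (6, 2, [(2, Under), (1, Cap)]), (5, 2, [(2, Under), (0, Over)]),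
    (7, 2, [(3, Over), (1, Cap)]), (6, 2, [(3, Over), (0, Over)]), (7, 2, [(1, Under), (0, Cap)]),
    (8, 2, [(2, Under), (0, Cap)]), (3, 2, [(3, Cup), (0, Over)]), (4, 2, [(2, Under), (0, Over)]),
    (2, 2, [(3, Cup), (1, Under)]), (9, 0, [(1, Over), (1, Under)]), (10, 2, [(0, Over), (1, Cap)]),
    (10, 0, [(2, Over), (2, Under)]), (11, 0, [(1, Over), (1, Under)]),
    (9, 3, [(2, Over), (1, Over), (2, Over)]), (8, 2, []), (7, 2, []),
    (5, 0, [(1, Under), (1, Over)]), (3, 0, [(2, Under), (2, Over)]),
    (4, 0, [(1, Under), (1, Over)]), (5, 0, [(2, Under), (2, Over)]),
    (6, 3, [(1, Over), (2, Over), (1, Over)]), (8, 2, []), (7, 2, []), (6, 2, []),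
    (2, 2, [(2, Cup), (3, Over)])]"]) code_simp+

lemma block5_equiv: "tangle_equiv 3 (THK3_braid 5) block5"
  by (rule derivation_imp_equiv[where ds = "[(2, 0, [(0, Under), (0, Over)]), (3, 0, [(1, Under), (1, Over)]),
    (4, 3, [(0, Over), (1, Over), (0, Over)]), (6, 2, []), (2, 0, [(1, Under), (1, Over)]),
    (0, 0, [(0, Under), (0, Over)]), (1, 0, [(1, Under), (1, Over)]),
    (2, 3, [(0, Over), (1, Over), (0, Over)]), (4, 2, []), (3, 2, []),
    (2, 0, [(1, Under), (1, Over)]), (3, 3, [(0, Over), (1, Over), (0, Over)]), (5, 2, []),
    (4, 2, []), (4, 0, [(1, Under), (1, Over)]), (5, 3, [(0, Over), (1, Over), (0, Over)]),
    (6, 0, [(1, Over), (1, Under)]), (8, 3, [(0, Over), (1, Over), (0, Over)]), (10, 2, []),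
    (6, 2, []), (6, 0, [(1, Under), (1, Over)]), (7, 3, [(0, Over), (1, Over), (0, Over)]),
    (8, 0, [(1, Over), (1, Under)]), (10, 3, [(0, Over), (1, Over), (0, Over)]), (12, 2, []),
    (8, 2, []), (7, 0, [(1, Cup), (2, Cap)]), (8, 2, [(0, Over), (2, Cap)]),
    (9, 2, [(0, Over), (2, Cap)]), (6, 2, [(1, Cup), (3, Under)]), (7, 2, [(0, Over), (3, Under)]),
    (8, 2, [(0, Over), (3, Under)]), (6, 2, [(0, Cup), (1, Under)]), (6, 1, [(0, Cup), (0, Under)]),
    (10, 0, [(1, Over), (1, Under)]), (11, 0, [(0, Over), (0, Under)]),
    (9, 3, [(1, Over), (0, Over), (1, Over)]), (8, 2, []), (7, 2, []),
    (5, 2, [(0, Cup), (2, Over)]), (4, 2, [(0, Cup), (3, Under)]), (3, 2, [(0, Cup), (2, Over)]),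
    (2, 2, [(0, Cup), (3, Under)]), (1, 2, [(0, Cup), (3, Under)]), (0, 2, [(0, Cup), (2, Under)]),
    (9, 2, [(3, Under), (1, Under)]), (10, 2, [(2, Over), (1, Cap)]),
    (11, 2, [(3, Over), (1, Cap)]), (12, 0, [(2, Over), (2, Under)]),
    (10, 3, [(3, Over), (2, Over), (3, Over)]), (9, 2, []), (8, 2, [(2, Over), (0, Under)]),
    (7, 0, [(2, Cup), (3, Cap)]), (6, 2, [(2, Cup), (4, Over)]), (5, 2, [(2, Cup), (5, Under)]),
    (7, 2, [(3, Under), (4, Cap)]), (8, 2, [(1, Over), (4, Cap)]), (9, 2, [(2, Over), (4, Cap)]),
    (7, 2, [(1, Over), (3, Under)]), (10, 2, [(0, Under), (4, Cap)]),
    (6, 2, [(1, Over), (5, Under)]), (7, 2, [(3, Under), (5, Under)]),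
    (4, 2, [(2, Cup), (4, Over)]), (5, 2, [(1, Over), (4, Over)]), (8, 2, [(2, Over), (5, Under)]),
    (9, 2, [(0, Under), (5, Under)]), (10, 2, [(4, Over), (5, Cap)]),
    (11, 2, [(3, Over), (5, Cap)]), (9, 0, [(4, Under), (4, Over)]),
    (8, 2, [(4, Under), (2, Over)]), (6, 0, [(3, Under), (3, Over)]),
    (7, 0, [(4, Under), (4, Over)]), (8, 3, [(3, Over), (4, Over), (3, Over)]), (10, 2, []),
    (9, 2, []), (5, 2, [(3, Under), (1, Over)]), (4, 2, [(3, Cup), (2, Over)]),
    (3, 2, [(3, Cup), (5, Under)]), (2, 2, [(3, Cup), (5, Under)]),
    (10, 0, [(3, Under), (3, Over)]), (8, 0, [(2, Under), (2, Over)]),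
    (9, 3, [(3, Over), (2, Over), (3, Over)]), (11, 2, []), (7, 2, [(2, Under), (4, Under)]),
    (5, 0, [(1, Under), (1, Over)]), (6, 3, [(2, Over), (1, Over), (2, Over)]), (8, 2, []),
    (4, 2, [(1, Under), (5, Under)]), (14, 0, [(3, Under), (3, Over)]),
    (15, 3, [(4, Over), (3, Over), (4, Over)]), (17, 2, [(5, Under), (4, Cap)]),
    (18, 2, [(2, Under), (4, Cap)]), (19, 2, [(1, Cap), (2, Cap)])]"]) code_simp+

text \<open>
The minima of \<open>block3\<close> and \<open>block5\<close> have the colors \<open>4\<close> and \<open>0, 4\<close>.
\<close>

lemma block_follow: "follow 7 [0, 1, 2, 4] [4, 0, 4] (block3 @ block5) [2, 2, 1] [2, 2, 1]"
  by code_simp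

lemma block8_equiv: "tangle_equiv 3 (THK3_braid 8) (block3 @ block5)"
proof -
  have split: "THK3_braid 8 = THK3_braid 3 @ THK3_braid 5"
    by (simp add: THK3_braid_def eval_nat_numeral)
  have tangle: "tangle 3 block3 3" "tangle 3 block5 3"
    by code_simp+
  have "tangle_equiv 3 ([] @ THK3_braid 3 @ THK3_braid 5) ([] @ block3 @ THK3_braid 5)"
    by (intro tangle_equiv_append block3_equiv tangle_THK3_braid) simp
  moreover have "tangle_equiv 3 (block3 @ THK3_braid 5 @ []) (block3 @ block5 @ [])"
    by (intro tangle_equiv_append block5_equiv tangle) simp
  ultimately show ?thesis
    unfolding split append_Nil append_Nil2 by (rule equivclp_trans)
qed

section \<open>The minimum number of colors\<close>

definition colorable_with :: "nat \<Rightarrow> link \<Rightarrow> nat \<Rightarrow> bool" where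
  "colorable_with r K k \<longleftrightarrow> (\<exists>D \<in> K. \<exists>C. nontrivial_coloring r D C \<and> card (colors_used C) = k)"

text \<open>
The two nested minima, over colorings of a diagram and over diagrams of the link, are one minimum
over all colored diagrams. The existence of a nontrivial coloring ensures that it is attained.
\<close>

lemma mincol_eq_iff:
  "mincol_eq r K k \<longleftrightarrow> colorable_with r K k \<and> (\<forall>j < k. \<not> colorable_with r K j)"
proof -
  have mincol: "mincol r K = (LEAST j. colorable_with r K j)" if "colorable_with r K k" for k
  proof -
    define l where "l = (LEAST j. colorable_with r K j)"
    have l: "colorable_with r K l" and least: "\<And>j. colorable_with r K j \<Longrightarrow> l \<le> j"
      unfolding l_def using that by (auto intro: LeastI Least_le)
    have colors: "l \<le> card (colors_used C)" if "D \<in> K" "nontrivial_coloring r D C" for D C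
      using that by (intro least) (auto simp: colorable_with_def)
    from l obtain D C where D: "D \<in> K" "nontrivial_coloring r D C" "card (colors_used C) = l"
      by (auto simp: colorable_with_def)
    have "min_colors_diagram r D = l"
      unfolding min_colors_diagram_def
      using D(2,3) colors[OF D(1)] by (intro Least_equality) blast+
    moreover have "l \<le> min_colors_diagram r D'" if "D' \<in> K" "nontrivial_coloring r D' C'" for D' C'
    proof -
      have "\<exists>C. nontrivial_coloring r D' C \<and> min_colors_diagram r D' = card (colors_used C)"
        unfolding min_colors_diagram_def by (rule LeastI_ex) (use that(2) in blast)
      with colors[OF that(1)] show ?thesis
        by auto
    qed
    ultimately show ?thesis
      unfolding mincol_def l_def[symmetric] using D(1,2) by (intro Least_equality) auto
  qed
  have admits: "admits_nontrivial r K \<longleftrightarrow> (\<exists>k. colorable_with r K k)"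
    by (auto simp: admits_nontrivial_def colorable_with_def)
  show ?thesis
  proof
    assume "mincol_eq r K k"
    then obtain j where j: "colorable_with r K j" and k: "mincol r K = k"
      by (auto simp: mincol_eq_def admits)
    then have "k = (LEAST j. colorable_with r K j)"
      using mincol by simp
    with j show "colorable_with r K k \<and> (\<forall>j < k. \<not> colorable_with r K j)"
      using LeastI not_less_Least by metis
  next
    assume k: "colorable_with r K k \<and> (\<forall>j < k. \<not> colorable_with r K j)"
    then have "(LEAST j. colorable_with r K j) = k"
      by (intro Least_equality) (auto simp: not_less[symmetric])
    with k show "mincol_eq r K k"
      using mincol admits by (auto simp: mincol_eq_def)
  qed
qed

text \<open>
The prime supplied by \<open>few_colors_small_prime\<close> is one of \<open>2, 3, 5, 7\<close>, and the nonconstant colorings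
modulo this prime restrict \<open>n\<close>.
\<close>

lemma THK3_few_colors_imp:
  assumes "n \<ge> 1" and "r > 1" and "colorable_with r (THK3 n) k" and "k \<in> {2, 3, 4}"
  shows "2 dvd r \<and> 3 dvd n \<or> k \<ge> 3 \<and> 3 dvd r \<and> 4 dvd n \<or>
    k \<ge> 4 \<and> (5 dvd r \<and> 2 dvd n \<or> 7 dvd r \<and> 8 dvd n)"
proof -
  from assms(3) obtain D C where D: "D \<in> THK3 n" and C: "nontrivial_coloring r D C" "card (colors_used C) = k"
    by (auto simp: colorable_with_def)
  have link: "nonconstant m D \<longleftrightarrow> nonconstant m (braid_closure 3 (THK3_braid n))" for m
    using D unfolding THK3_def by (rule nonconstant_link)
  have "run r D [] (colors_used C) []"
    using C(1) D assms(2)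
    by (intro coloring_imp_run) (auto simp: nontrivial_coloring_def THK3_def link_of_def)
  moreover have "\<not> nonconstant 0 D"
    using assms(1) nonconstant_closure_0 by (simp add: link)
  ultimately obtain p where p: "prime p" "p dvd r" "p \<le> 2 ^ (k - 1)" "nonconstant p D"
    using few_colors_small_prime[of r D "colors_used C"] C(2) assms(2,4) by auto
  from p(1,4) have lucas: "even_lucas n mod int p = 2 mod int p"
    by (intro nonconstant_closure_prime) (simp_all add: link)
  have "p \<le> 8"
    using p(3) assms(4) by auto
  have odd: "p = 2" if "even p"
    using that p(1) primes_dvd_imp_eq two_is_prime_nat by blast
  have "p = 2 \<or> p = 3 \<or> p = 5 \<or> p = 7"
    using \<open>p \<le> 8\<close> prime_gt_1_nat[OF p(1)] odd by presburger
  then show ?thesis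
    using lucas p(2,3) assms(4) even_lucas_mod_primes[of n] by auto
qed

text \<open>
The initial levels list the colors \<open>s 1, s 2, s 0\<close> of the sequences \<open>0, 1, 1, 2, \<dots>\<close> modulo \<open>2\<close> and
\<open>3\<close>, \<open>3 ^ k\<close> modulo \<open>5\<close>, and \<open>4 ^ k\<close> modulo \<open>11\<close>.
\<close>

lemma THK3_colorable:
  assumes "n \<ge> 1" and "r > 1"
  shows "2 dvd r \<Longrightarrow> 3 dvd n \<Longrightarrow> \<exists>k \<le> 2. colorable_with r (THK3 n) k"
    and "3 dvd r \<Longrightarrow> 4 dvd n \<Longrightarrow> \<exists>k \<le> 3. colorable_with r (THK3 n) k"
    and "5 dvd r \<Longrightarrow> 2 dvd n \<Longrightarrow> \<exists>k \<le> 4. colorable_with r (THK3 n) k"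
    and "7 dvd r \<Longrightarrow> 8 dvd n \<Longrightarrow> \<exists>k \<le> 4. colorable_with r (THK3 n) k"
    and "11 dvd r \<Longrightarrow> 5 dvd n \<Longrightarrow> \<exists>k \<le> 5. colorable_with r (THK3 n) k"
proof -
  have block: "\<exists>k \<le> card (set L). colorable_with r (THK3 n) k"
    if "tangle_equiv 3 (THK3_braid q) W" "tangle 3 W 3" "follow p L ys W [a, b, c] [a, b, c]"
      "{a, b, c} \<subseteq> {0..<int p}" "\<not> (a = b \<and> b = c)" "p > 0" "p dvd r" "q dvd n" for p q L ys W a b c
    using THK3_colored_by_block[OF that(6,7) _ that(1-5,8)] assms by (auto simp: colorable_with_def)
  have standard: "\<exists>k \<le> card (set L). colorable_with r (THK3 n) k"
    if "follow p L [] (THK3_braid q) [a, b, c] [a, b, c]"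
      "{a, b, c} \<subseteq> {0..<int p}" "\<not> (a = b \<and> b = c)" "p > 0" "p dvd r" "q dvd n" for p q L a b c
    using block[OF equivclp_refl tangle_THK3_braid that] .
  have "follow 2 [0, 1] [] (THK3_braid 3) [1, 1, 0] [1, 1, 0]"
    by code_simp
  from standard[OF this] show "2 dvd r \<Longrightarrow> 3 dvd n \<Longrightarrow> \<exists>k \<le> 2. colorable_with r (THK3 n) k"
    by (simp add: numeral_eq_Suc)
  have "follow 3 [0, 1, 2] [] (THK3_braid 4) [1, 1, 0] [1, 1, 0]"
    by code_simp
  from standard[OF this] show "3 dvd r \<Longrightarrow> 4 dvd n \<Longrightarrow> \<exists>k \<le> 3. colorable_with r (THK3 n) k"
    by (simp add: numeral_eq_Suc)
  have "follow 5 [1, 2, 3, 4] [] (THK3_braid 2) [3, 4, 1] [3, 4, 1]"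
    by code_simp
  from standard[OF this] show "5 dvd r \<Longrightarrow> 2 dvd n \<Longrightarrow> \<exists>k \<le> 4. colorable_with r (THK3 n) k"
    by (simp add: numeral_eq_Suc)
  have "follow 11 [1, 3, 4, 5, 9] [] (THK3_braid 5) [4, 5, 1] [4, 5, 1]"
    by code_simp
  from standard[OF this] show "11 dvd r \<Longrightarrow> 5 dvd n \<Longrightarrow> \<exists>k \<le> 5. colorable_with r (THK3 n) k"
    by (simp add: numeral_eq_Suc)
  have "tangle 3 (block3 @ block5) 3"
    by code_simp
  from block[OF block8_equiv this block_follow] show
    "7 dvd r \<Longrightarrow> 8 dvd n \<Longrightarrow> \<exists>k \<le> 4. colorable_with r (THK3 n) k"
    by (simp add: numeral_eq_Suc)
qed

theorem theorem1p2:
  fixes n r :: nat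
  assumes "n \<ge> 1" and "r > 1"
  shows "(2 dvd r \<and> 3 dvd n \<longleftrightarrow> mincol_eq r (THK3 n) 2)
    \<and> ((\<not> 2 dvd r \<or> \<not> 3 dvd n) \<and> 3 dvd r \<and> 4 dvd n \<longleftrightarrow> mincol_eq r (THK3 n) 3)
    \<and> ((\<not> 2 dvd r \<or> \<not> 3 dvd n) \<and> (\<not> 3 dvd r \<or> \<not> 4 dvd n)
         \<and> ((5 dvd r \<and> 2 dvd n) \<or> (7 dvd r \<and> 8 dvd n)) \<longleftrightarrow> mincol_eq r (THK3 n) 4)
    \<and> ((\<not> 2 dvd r \<or> \<not> 3 dvd n) \<and> (\<not> 3 dvd r \<or> \<not> 4 dvd n)
         \<and> (\<not> 5 dvd r \<or> \<not> 2 dvd n) \<and> (\<not> 7 dvd r \<or> \<not> 8 dvd n)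
         \<and> 11 dvd r \<and> 5 dvd n \<longrightarrow> mincol_eq r (THK3 n) 5)"
proof -
  define Q where "Q = colorable_with r (THK3 n)"
  define c2 c3 c4 c5 where "c2 \<longleftrightarrow> 2 dvd r \<and> 3 dvd n" and "c3 \<longleftrightarrow> 3 dvd r \<and> 4 dvd n"
    and "c4 \<longleftrightarrow> 5 dvd r \<and> 2 dvd n \<or> 7 dvd r \<and> 8 dvd n" and "c5 \<longleftrightarrow> 11 dvd r \<and> 5 dvd n"
  note defs = Q_def c2_def c3_def c4_def c5_def
  have nontrivial: "\<not> Q 0" "\<not> Q 1"
    by (auto simp: Q_def colorable_with_def nontrivial_coloring_def)
  have lower: "Q 2 \<Longrightarrow> c2" "Q 3 \<Longrightarrow> c2 \<or> c3" "Q 4 \<Longrightarrow> c2 \<or> c3 \<or> c4"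
    using THK3_few_colors_imp[OF assms, of 2] THK3_few_colors_imp[OF assms, of 3]
      THK3_few_colors_imp[OF assms, of 4] unfolding defs by auto
  have upper: "c2 \<Longrightarrow> \<exists>k \<le> 2. Q k" "c3 \<Longrightarrow> \<exists>k \<le> 3. Q k" "c4 \<Longrightarrow> \<exists>k \<le> 4. Q k" "c5 \<Longrightarrow> \<exists>k \<le> 5. Q k"
    using THK3_colorable[OF assms] unfolding defs by blast+
  have upto: "(\<exists>k \<le> 2. Q k) \<longleftrightarrow> Q 2" "(\<exists>k \<le> 3. Q k) \<longleftrightarrow> Q 2 \<or> Q 3"
    "(\<exists>k \<le> 4. Q k) \<longleftrightarrow> Q 2 \<or> Q 3 \<or> Q 4" "(\<exists>k \<le> 5. Q k) \<longleftrightarrow> Q 2 \<or> Q 3 \<or> Q 4 \<or> Q 5"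
    using nontrivial by (auto simp: le_Suc_eq numeral_eq_Suc)
  have "mincol_eq r (THK3 n) 2 \<longleftrightarrow> Q 2" "mincol_eq r (THK3 n) 3 \<longleftrightarrow> Q 3 \<and> \<not> Q 2"
    "mincol_eq r (THK3 n) 4 \<longleftrightarrow> Q 4 \<and> \<not> Q 2 \<and> \<not> Q 3"
    "mincol_eq r (THK3 n) 5 \<longleftrightarrow> Q 5 \<and> \<not> Q 2 \<and> \<not> Q 3 \<and> \<not> Q 4"
    unfolding mincol_eq_iff Q_def[symmetric]
    using nontrivial by (auto simp: less_Suc_eq numeral_eq_Suc)
  moreover have "(c2 \<longleftrightarrow> Q 2) \<and> (\<not> c2 \<and> c3 \<longleftrightarrow> Q 3 \<and> \<not> Q 2) \<and>
      (\<not> c2 \<and> \<not> c3 \<and> c4 \<longleftrightarrow> Q 4 \<and> \<not> Q 2 \<and> \<not> Q 3) \<and>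
      (\<not> c2 \<and> \<not> c3 \<and> \<not> c4 \<and> c5 \<longrightarrow> Q 5 \<and> \<not> Q 2 \<and> \<not> Q 3 \<and> \<not> Q 4)"
    using lower upper unfolding upto by blast
  ultimately show ?thesis
    unfolding c2_def c3_def c4_def c5_def by blast
qed

end
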